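(* Let $(m_n)$ be a sequence of positive integers with $m_n/n\to\alpha\in(0,\infty)$ as $n\to\infty$. Then, for the random matrix model and with $F_\rho,\alpha^*_\rho$ as in the context, $$\lim_{n\to\infty} n^{-1}\log\mathbb{E}[\mathcal{N}(n,m_n)]=F_\rho(\alpha);$$ in particular, this limit is strictly positive for $\alpha>\alpha^*_\rho$ and zero for $\alpha\le\alpha^*_\rho$. Moreover, if in addition there exist integers $r_0\ge 3$ and $r_1<\infty$ such that $\mathbb{P}[r_0\le W_n\le r_1]=1$ for all sufficiently large $n$, and $\alpha\in(0,\alpha^*_\rho)$, then as $n\to\infty$, $$\mathbb{E}[\mathcal{N}(n,m_n)]=1+O(n^{2-r_0}).$$
   Context: Convention: $0^0:=1$. Let $W$ be an $\mathbb{N}$-valued random variable ($\mathbb{N}=\{1,2,\ldots\}$) with $\rho(s):=\mathbb{E}[s^W]$. For each $n\in\mathbb{N}$ let $W_n$ be a random variable with values in $\{1,\ldots,n\}$, such that $W_n$ converges to $W$ in distribution as $n\to\infty$. The weight of a $0$-$1$ vector is its number of ones. For $m\in\mathbb{N}$, $M(n,m)$ is the random $m\times n$ matrix with entries in $\{0,1\}$ whose rows are i.i.d., where each row has weight distributed as $W_n$ and, conditionally on its weight being $k$, is uniformly distributed over the vectors in $\{0,1\}^n$ of weight $k$. $\mathcal{N}(n,m)$ is the (random) number of row vectors $a\in\{0,1\}^m$, including the zero vector, with $a\,M(n,m)\equiv \mathbf{0}$ (mod 2). For $\alpha\ge 0$ define $$F_\rho(\alpha):=\log\sup_{\gamma\in[0,1/2]}\left(\frac{(1+\rho(1-2\gamma))^\alpha}{2\gamma^\gamma(1-\gamma)^{1-\gamma}}\right),\qquad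 \alpha^*_\rho:=\inf\{\alpha\ge 0: F_\rho(\alpha)>0\}.$$ *)

theory Defs
  imports "HOL-Probability.Probability" "HOL-Library.Landau_Symbols" "HOL-Number_Theory.Cong"
begin

text \<open>Real power with the convention \<open>0\<^sup>0 = 1\<close>; the library's \<open>0 powr 0\<close> is \<open>0\<close>.\<close>

definition pow0 :: "real \<Rightarrow> real \<Rightarrow> real" where
  "pow0 x y = (if x = 0 \<and> y = 0 then 1 else x powr y)"

definition gen_fun :: "nat pmf \<Rightarrow> real \<Rightarrow> real" where
  "gen_fun W s = measure_pmf.expectation W (\<lambda>k. s ^ k)"

text \<open>
  For \<open>\<rho> = gen_fun W\<close> and \<open>\<alpha> \<ge> 0\<close> the supremum in \<open>F_rho\<close> is over a non-empty bounded set
  (the value at \<open>\<gamma> = 1/2\<close> is \<open>1\<close> if \<open>0 \<notin> set_pmf W\<close>), and the set in \<open>alpha_star\<close>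
  contains every \<open>\<alpha> > 1\<close> (take \<open>\<gamma> = 0\<close>), so both are genuine real numbers.
\<close>

definition F_rho :: "(real \<Rightarrow> real) \<Rightarrow> real \<Rightarrow> real" where
  "F_rho \<rho> \<alpha> = ln (SUP \<gamma>\<in>{0..1/2}.
     pow0 (1 + \<rho> (1 - 2 * \<gamma>)) \<alpha> / (2 * pow0 \<gamma> \<gamma> * pow0 (1 - \<gamma>) (1 - \<gamma>)))"

definition alpha_star :: "(real \<Rightarrow> real) \<Rightarrow> real" where
  "alpha_star \<rho> = Inf {\<alpha>. \<alpha> \<ge> 0 \<and> F_rho \<rho> \<alpha> > 0}"

definition binary_vectors :: "nat \<Rightarrow> (nat \<Rightarrow> nat) set" where
  "binary_vectors n = {..<n} \<rightarrow>\<^sub>E {0, 1}"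

definition weight :: "nat \<Rightarrow> (nat \<Rightarrow> nat) \<Rightarrow> nat" where
  "weight n v = card {j \<in> {..<n}. v j = 1}"

text \<open>
  Law of a row of length \<open>n\<close> whose weight has law \<open>w\<close>. It is meaningful when
  \<open>set_pmf w \<subseteq> {0..n}\<close>, since otherwise \<open>pmf_of_set\<close> is applied to an empty set.
\<close>

definition row_pmf :: "nat pmf \<Rightarrow> nat \<Rightarrow> (nat \<Rightarrow> nat) pmf" where
  "row_pmf w n = bind_pmf w (\<lambda>k. pmf_of_set {v \<in> binary_vectors n. weight n v = k})"

text \<open>
  Law of the \<open>m \<times> n\<close> matrix \<open>M\<close> with i.i.d. rows \<open>M 0, \<dots>, M (m - 1)\<close>; entry \<open>(i, j)\<close> is
  \<open>M i j\<close>. (\<open>undefined\<close> only fixes the value of \<open>M i\<close> for \<open>i \<ge> m\<close>.)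
\<close>

definition matrix_pmf :: "nat pmf \<Rightarrow> nat \<Rightarrow> nat \<Rightarrow> (nat \<Rightarrow> nat \<Rightarrow> nat) pmf" where
  "matrix_pmf w n m = Pi_pmf {..<m} undefined (\<lambda>_. row_pmf w n)"

definition null_count :: "nat \<Rightarrow> nat \<Rightarrow> (nat \<Rightarrow> nat \<Rightarrow> nat) \<Rightarrow> nat" where
  "null_count n m M =
     card {a \<in> binary_vectors m. \<forall>j<n. [(\<Sum>i<m. a i * M i j) = 0] (mod 2)}"

definition expected_null_count :: "nat pmf \<Rightarrow> nat \<Rightarrow> nat \<Rightarrow> real" where
  "expected_null_count w n m =
     measure_pmf.expectation (matrix_pmf w n m) (\<lambda>M. real (null_count n m M))"

text \<open>Convergence in distribution, for laws on \<open>nat\<close> regarded as laws on the real line.\<close>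

definition converges_in_distribution :: "(nat \<Rightarrow> nat pmf) \<Rightarrow> nat pmf \<Rightarrow> bool" where
  "converges_in_distribution Wn W \<longleftrightarrow>
     weak_conv_m (\<lambda>n. distr (measure_pmf (Wn n)) borel real) (distr (measure_pmf W) borel real)"

end

theory Submission
  imports Defs "HOL-Real_Asymp.Real_Asymp"
begin

text \<open>
  Expanding the event \<open>a M \<equiv> 0 (mod 2)\<close> in characters of \<open>(\<int>/2)\<^sup>n\<close> and using independence of the
  rows gives the exact formula
  \<open>E N(n,m) = 2\<^sup>-\<^sup>n \<Sum>\<^sub>S (1 + \<lambda>(S))\<^sup>m\<close> over \<open>S \<subseteq> [n]\<close>, where \<open>\<lambda>(S)\<close> is the mean character of a row,
  an average of normalised Krawtchouk values. Their three-term recurrence shows that \<open>\<lambda>(S)\<close> is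
  uniformly close to \<open>\<rho>(x)\<close>, \<open>x = 1 - 2|S|/n\<close>, so the growth rate follows from Laplace's method with
  the entropy bounds on binomial coefficients.

  For the error term, \<open>\<Sum>\<^sub>S \<lambda>(S) = 0\<close> because no row vanishes, so only
  \<open>(1 + \<lambda>)\<^sup>m - 1 - m \<lambda>\<close> has to be averaged. The same recurrence gives
  \<open>|\<lambda>| = O((|x| + n\<^sup>-\<^sup>1\<^sup>/\<^sup>2)\<^sup>r)\<close> with \<open>r = r0\<close>; near \<open>x = 0\<close> the second-order term
  \<open>m\<^sup>2 \<lambda>\<^sup>2\<close> is then of order \<open>n\<^sup>2\<^sup>-\<^sup>r\<close> up to a Gaussian factor \<open>exp (n x\<^sup>2/4)\<close> with bounded mean.
  Away from \<open>x = 0\<close> the terms are exponentially small: if \<open>\<alpha> < \<beta> < \<beta>' < \<alpha>\<^sup>*\<close>, then \<open>F(\<beta>') = 0\<close>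
  bounds the exponent at \<open>\<beta>\<close> by \<open>(1 - \<beta>/\<beta>') (H - ln 2)\<close>, \<open>H\<close> being the binary entropy.
\<close>

section \<open>Elementary symmetric polynomials of signs\<close>

definition elem_sym :: "(nat \<Rightarrow> real) \<Rightarrow> nat \<Rightarrow> nat \<Rightarrow> real" where
  "elem_sym e n w = (\<Sum>T | T \<subseteq> {..<n} \<and> card T = w. \<Prod>i\<in>T. e i)"

lemma elem_sym_0 [simp]: "elem_sym e n 0 = 1"
proof -
  have "{T. T \<subseteq> {..<n} \<and> card T = 0} = {{}}"
    by (auto dest: finite_subset)
  then show ?thesis by (simp add: elem_sym_def)
qed

lemma elem_sym_zero_Suc [simp]: "elem_sym e 0 (Suc w) = 0"
proof -
  have "{T. T \<subseteq> {..<0::nat} \<and> card T = Suc w} = {}" by auto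
  then show ?thesis by (simp only: elem_sym_def sum.empty)
qed

text \<open>Pascal's rule for signed sums: sort the subsets of size \<open>Suc w\<close> by whether
  they contain \<open>n\<close>.\<close>

lemma elem_sym_Suc_Suc: "elem_sym e (Suc n) (Suc w) = elem_sym e n (Suc w) + e n * elem_sym e n w"
proof -
  let ?A = "{T. T \<subseteq> {..<n} \<and> card T = Suc w}" and ?B = "{T. T \<subseteq> {..<n} \<and> card T = w}"
  have fin: "finite T" if "T \<subseteq> {..<n}" for T :: "nat set" using that finite_subset by blast
  have split: "{T. T \<subseteq> {..<Suc n} \<and> card T = Suc w} = ?A \<union> insert n ` ?B" (is "?L = ?R")
  proof
    show "?L \<subseteq> ?R"
    proof
      fix T assume T: "T \<in> ?L"
      show "T \<in> ?R"
      proof (cases "n \<in> T")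
        case True
        have "T - {n} \<in> ?B" using T True by (auto simp: less_Suc_eq)
        moreover have "T = insert n (T - {n})" using True by auto
        ultimately show ?thesis by blast
      next
        case False
        then show ?thesis using T by (auto simp: less_Suc_eq)
      qed
    qed
    show "?R \<subseteq> ?L"
    proof
      fix T assume "T \<in> ?R"
      then consider "T \<in> ?A" | U where "U \<in> ?B" "T = insert n U" by blast
      then show "T \<in> ?L"
      proof cases
        case 1 then show ?thesis by auto
      next
        case 2
        then have "n \<notin> U" "finite U" using fin by auto
        then show ?thesis using 2 by (auto simp: less_Suc_eq)
      qed
    qed
  qed
  have inj: "inj_on (insert n) ?B"
  proof (rule inj_onI)
    fix T U assume "T \<in> ?B" "U \<in> ?B" "insert n T = insert n U"
    moreover from this have "n \<notin> T" "n \<notin> U" by auto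
    ultimately show "T = U" by (metis insert_ident)
  qed
  have "elem_sym e (Suc n) (Suc w) = (\<Sum>T\<in>?A. prod e T) + (\<Sum>T\<in>insert n ` ?B. prod e T)"
    unfolding elem_sym_def split by (rule sum.union_disjoint) auto
  also have "(\<Sum>T\<in>insert n ` ?B. prod e T) = (\<Sum>T\<in>?B. prod e (insert n T))"
    by (subst sum.reindex[OF inj]) simp
  also have "\<dots> = (\<Sum>T\<in>?B. e n * prod e T)"
  proof (rule sum.cong[OF refl])
    fix T assume "T \<in> ?B"
    then have "n \<notin> T" "finite T" using fin by auto
    then show "prod e (insert n T) = e n * prod e T" by simp
  qed
  finally show ?thesis by (simp add: elem_sym_def sum_distrib_left)
qed

lemma elem_sym_one: "elem_sym e n (Suc 0) = (\<Sum>i<n. e i)"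
  by (induction n) (simp_all add: elem_sym_Suc_Suc)

text \<open>Compare coefficients in \<open>(1 - z\<^sup>2) f' = (s - n z) f\<close> for \<open>f = \<Prod>\<^sub>i (1 + e\<^sub>i z)\<close>.\<close>

lemma elem_sym_recurrence:
  assumes "\<And>i. e i ^ 2 = 1"
  shows "(real w + 2) * elem_sym e n (Suc (Suc w))
           = (\<Sum>i<n. e i) * elem_sym e n (Suc w) - (real n - real w) * elem_sym e n w"
proof (induction n arbitrary: w)
  case 0
  show ?case by (cases w) auto
next
  case (Suc n)
  have sq: "e n * e n = 1" using assms[of n] by (simp add: power2_eq_square)
  show ?case
  proof (cases w)
    case 0
    have "2 * elem_sym e n (Suc (Suc 0)) = (\<Sum>i<n. e i) * (\<Sum>i<n. e i) - real n"
      using Suc[of 0] by (simp add: elem_sym_one)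
    then show ?thesis
      using sq by (simp add: 0 elem_sym_Suc_Suc elem_sym_one algebra_simps)
  next
    case (Suc v)
    define s where "s = (\<Sum>i<n. e i)"
    have 1: "(real v + 3) * elem_sym e n (Suc (Suc (Suc v)))
        = s * elem_sym e n (Suc (Suc v)) - (real n - real v - 1) * elem_sym e n (Suc v)"
      using Suc.IH[of "Suc v"] by (simp add: s_def algebra_simps)
    have 2: "(real v + 2) * elem_sym e n (Suc (Suc v))
        = s * elem_sym e n (Suc v) - (real n - real v) * elem_sym e n v"
      using Suc.IH[of v] by (simp add: s_def)
    \<comment> \<open>On the summand with \<open>e n\<close> the factor \<open>v + 3\<close> is
      split as \<open>(v + 2) + 1\<close>, so that the hypotheses for \<open>Suc v\<close> and for
      \<open>v\<close> both apply. What is left over carries the factor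
      \<open>1 - e n * e n = 0\<close>.\<close>
    have "(real (Suc v) + 2) * elem_sym e (Suc n) (Suc (Suc (Suc v)))
      = (real v + 3) * elem_sym e n (Suc (Suc (Suc v)))
        + e n * ((real v + 2) * elem_sym e n (Suc (Suc v))) + e n * elem_sym e n (Suc (Suc v))"
      by (simp add: elem_sym_Suc_Suc algebra_simps)
    also have "\<dots> = (s + e n) * (elem_sym e n (Suc (Suc v)) + e n * elem_sym e n (Suc v))
        - (real n - real v) * (elem_sym e n (Suc v) + e n * elem_sym e n v)
        + (1 - e n * e n) * elem_sym e n (Suc v)"
      unfolding 1 2 by (simp add: algebra_simps)
    finally show ?thesis
      by (simp add: sq Suc elem_sym_Suc_Suc s_def algebra_simps)
  qed
qed

section \<open>Character expansion of the expectation\<close>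

definition sign_of :: "nat set \<Rightarrow> nat \<Rightarrow> real" where
  "sign_of S i = (if i \<in> S then -1 else 1)"

lemma sign_of_sq [simp]: "sign_of S i ^ 2 = 1"
  by (simp add: sign_of_def)

lemma sum_sign_of: "S \<subseteq> {..<n} \<Longrightarrow> (\<Sum>i<n. sign_of S i) = real n - 2 * real (card S)"
proof -
  assume S: "S \<subseteq> {..<n}"
  have "(\<Sum>i<n. sign_of S i) = (\<Sum>i<n. 1 - 2 * (if i \<in> S then 1 else 0))"
    by (intro sum.cong) (auto simp: sign_of_def)
  also have "\<dots> = real n - 2 * (\<Sum>i<n. if i \<in> S then 1 else 0)"
    by (simp add: sum_subtractf sum_distrib_left)
  also have "(\<Sum>i<n. if i \<in> S then 1 else 0 :: real) = real (card S)"
    using S by (subst sum.inter_restrict[symmetric]) (auto simp: Int_absorb1)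
  finally show ?thesis .
qed

text \<open>Multiplying out the right-hand product selects one summand per index; \<open>S\<close>
  records the indices at which the summand at \<open>-1\<close> was taken.\<close>

lemma sum_Pow_prod_sign:
  fixes g :: "real \<Rightarrow> nat \<Rightarrow> real"
  assumes "finite I"
  shows "(\<Sum>S\<in>Pow I. \<Prod>j\<in>I. g (sign_of S j) j) = (\<Prod>j\<in>I. g (-1) j + g 1 j)"
proof -
  have "(\<Prod>j\<in>S. g (-1) j) * (\<Prod>j\<in>I-S. g 1 j) = (\<Prod>j\<in>I. g (sign_of S j) j)" if "S \<subseteq> I" for S
  proof -
    have "(\<Prod>j\<in>I. g (sign_of S j) j) = (\<Prod>j\<in>I-S. g (sign_of S j) j) * (\<Prod>j\<in>S. g (sign_of S j) j)"
      using assms that by (rule prod.subset_diff[rotated])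
    also have "\<dots> = (\<Prod>j\<in>I-S. g 1 j) * (\<Prod>j\<in>S. g (-1) j)"
      by (intro arg_cong2[where f = "(*)"] prod.cong) (auto simp: sign_of_def)
    finally show ?thesis by simp
  qed
  then show ?thesis using assms by (subst prod_add) (auto intro!: sum.cong)
qed

text \<open>The real character of (Z/2)^n indexed by \<open>S\<close>. Entries enter as exponents,
  so it also applies to vectors of natural numbers, such as \<open>a M\<close> before reduction mod
  2.\<close>

definition character :: "nat \<Rightarrow> nat set \<Rightarrow> (nat \<Rightarrow> nat) \<Rightarrow> real" where
  "character n S v = (\<Prod>j<n. sign_of S j ^ v j)"

text \<open>Orthogonality: the sum factors over the coordinates, and an odd coordinate contributes
  the factor \<open>-1 + 1 = 0\<close>.\<close>

lemma sum_characters: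
  "(\<Sum>S\<in>Pow {..<n}. character n S c) = (if \<forall>j<n. even (c j) then 2 ^ n else 0)"
proof -
  have "(\<Sum>S\<in>Pow {..<n}. character n S c) = (\<Prod>j<n. (-1) ^ c j + 1)"
    unfolding character_def by (subst sum_Pow_prod_sign) auto
  also have "\<dots> = (if \<forall>j<n. even (c j) then 2 ^ n else 0)"
  proof (cases "\<forall>j<n. even (c j)")
    case True
    then have "(\<Prod>j<n. (-1) ^ c j + 1) = (\<Prod>j<n. 2 :: real)"
      by (intro prod.cong) auto
    then show ?thesis using True by simp
  next
    case False
    then obtain j where "j < n" "odd (c j)" by auto
    then have "(\<Prod>j<n. (-1) ^ c j + 1 :: real) = 0" by (intro prod_zero bexI[of _ j]) auto
    then show ?thesis using False by auto
  qed
  finally show ?thesis .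
qed

lemma character_eq_1_or_minus_1: "character n S v \<in> {-1, 1}"
proof (induction n)
  case (Suc n)
  have "sign_of S n ^ v n \<in> {-1, 1}" by (cases "even (v n)") (auto simp: sign_of_def)
  moreover have "character n S v \<in> {-1, 1}" by (fact Suc)
  moreover have "character (Suc n) S v = character n S v * sign_of S n ^ v n"
    by (simp add: character_def)
  ultimately show ?case by auto
qed (simp add: character_def)

lemma character_linear:
  "character n S (\<lambda>j. \<Sum>i<m. a i * M i j) = (\<Prod>i<m. character n S (M i) ^ a i)"
  by (simp add: character_def power_sum prod_power_distrib power_mult[symmetric] mult.commute)
     (rule prod.swap)

lemma finite_binary_vectors [simp]: "finite (binary_vectors n)"
  by (simp add: binary_vectors_def finite_PiE)

text \<open>The indicator of \<open>a M = 0\<close> is replaced by a sum over characters. For fixed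
  \<open>S\<close> the summand is a product over the rows, so summing over \<open>a\<close> lets
  each row choose between exponent 0 and exponent 1 independently.\<close>

lemma null_count_eq:
  "2 ^ n * real (null_count n m M) = (\<Sum>S\<in>Pow {..<n}. \<Prod>i<m. 1 + character n S (M i))"
proof -
  have "2 ^ n * real (null_count n m M) = (\<Sum>a\<in>binary_vectors m.
      if \<forall>j<n. even (\<Sum>i<m. a i * M i j) then 2 ^ n else 0)"
    unfolding null_count_def
    by (subst sum.inter_filter[symmetric]) (auto simp: cong_0_iff)
  also have "\<dots> = (\<Sum>a\<in>binary_vectors m. \<Sum>S\<in>Pow {..<n}. \<Prod>i<m. character n S (M i) ^ a i)"
    by (simp only: sum_characters[symmetric] character_linear)
  also have "\<dots> = (\<Sum>S\<in>Pow {..<n}. \<Sum>a\<in>binary_vectors m. \<Prod>i<m. character n S (M i) ^ a i)"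
    by (rule sum.swap)
  also have "\<dots> = (\<Sum>S\<in>Pow {..<n}. \<Prod>i<m. \<Sum>b\<in>{0,1}. character n S (M i) ^ b)"
    unfolding binary_vectors_def by (subst prod_sum_PiE) auto
  finally show ?thesis by simp
qed

section \<open>Random rows and Krawtchouk values\<close>

lemma bij_betw_support:
  "bij_betw (\<lambda>v. {j. j < n \<and> v j = 1}) {v \<in> binary_vectors n. weight n v = k}
     {T. T \<subseteq> {..<n} \<and> card T = k}"
\<comment> \<open>The inverse is the indicator function restricted to \<open>{..<n}\<close>, because
  members of \<open>binary_vectors n\<close> are \<open>undefined\<close> outside that
  range.\<close>
proof (rule bij_betw_byWitness[where f' = "\<lambda>T. restrict (\<lambda>j. if j \<in> T then 1 else 0) {..<n}"])
  show "\<forall>v\<in>{v \<in> binary_vectors n. weight n v = k}.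
      restrict (\<lambda>j. if j \<in> {j. j < n \<and> v j = 1} then 1 else 0) {..<n} = v"
    by (auto simp: binary_vectors_def fun_eq_iff PiE_def extensional_def Pi_def)
  show "\<forall>T\<in>{T. T \<subseteq> {..<n} \<and> card T = k}.
      {j. j < n \<and> restrict (\<lambda>j. if j \<in> T then 1 else 0) {..<n} j = (1::nat)} = T"
    by auto
  show "(\<lambda>v. {j. j < n \<and> v j = 1}) ` {v \<in> binary_vectors n. weight n v = k}
      \<subseteq> {T. T \<subseteq> {..<n} \<and> card T = k}"
    by (auto simp: weight_def)
  have "{j. j < n \<and> restrict (\<lambda>j. if j \<in> T then 1 else 0) {..<n} j = (1::nat)} = T"
    if "T \<subseteq> {..<n}" for T using that by auto
  then show "(\<lambda>T. restrict (\<lambda>j. if j \<in> T then 1 else 0) {..<n}) ` {T. T \<subseteq> {..<n} \<and> card T = k}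
      \<subseteq> {v \<in> binary_vectors n. weight n v = k}"
    by (auto simp: weight_def binary_vectors_def split: if_splits)
qed

lemma sum_character_weight:
  "(\<Sum>v | v \<in> binary_vectors n \<and> weight n v = k. character n S v) = elem_sym (sign_of S) n k"
  unfolding elem_sym_def
proof (subst sum.reindex_bij_betw[OF bij_betw_support, symmetric], rule sum.cong[OF refl])
  fix v assume v: "v \<in> {v \<in> binary_vectors n. weight n v = k}"
  \<comment> \<open>With entries 0 and 1 only the support of \<open>v\<close> contributes
    signs.\<close>
  have "character n S v = (\<Prod>j<n. if v j = 1 then sign_of S j else 1)"
    unfolding character_def using v
    by (intro prod.cong) (auto simp: binary_vectors_def PiE_def Pi_def)
  also have "\<dots> = prod (sign_of S) {j. j < n \<and> v j = 1}"
    by (subst prod.inter_filter[symmetric]) auto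
  finally show "character n S v = prod (sign_of S) {j. j < n \<and> v j = 1}" .
qed

lemma card_weight: "card {v \<in> binary_vectors n. weight n v = k} = n choose k"
  using bij_betw_same_card[OF bij_betw_support[of n k]] n_subsets[of "{..<n}" k] by simp

text \<open>For \<open>S\<close> inside \<open>{..<n}\<close> the numerator is the binary Krawtchouk
  polynomial of degree \<open>k\<close> at \<open>card S\<close>. Dividing by the number of vectors
  of weight \<open>k\<close> makes it the mean of \<open>character n S\<close> over them.\<close>

definition krawtchouk :: "nat \<Rightarrow> nat set \<Rightarrow> nat \<Rightarrow> real" where
  "krawtchouk n S k = elem_sym (sign_of S) n k / real (n choose k)"

text \<open>Defined from the weight law alone, so that bounds on Krawtchouk values pass to it under
  the expectation; \<open>expectation_character_row\<close> identifies it with the mean character of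
  a random row.\<close>

definition mean_char :: "nat pmf \<Rightarrow> nat \<Rightarrow> nat set \<Rightarrow> real" where
  "mean_char w n S = measure_pmf.expectation w (krawtchouk n S)"

lemma finite_set_pmf_row:
  assumes "set_pmf w \<subseteq> {1..n}"
  shows "finite (set_pmf (row_pmf w n))"
proof -
  have "set_pmf (row_pmf w n) \<subseteq> binary_vectors n"
  proof -
    have "set_pmf (pmf_of_set {v \<in> binary_vectors n. weight n v = k}) \<subseteq> binary_vectors n"
      if "k \<in> set_pmf w" for k
    proof (subst set_pmf_of_set)
      have "k \<le> n" using that assms by auto
      then have "card {v \<in> binary_vectors n. weight n v = k} > 0" by (simp add: card_weight)
      then show "{v \<in> binary_vectors n. weight n v = k} \<noteq> {}"
        by (metis card.empty less_numeral_extra(3))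
    qed auto
    then show ?thesis by (auto simp: row_pmf_def)
  qed
  then show ?thesis by (rule finite_subset) simp
qed

lemma expectation_character_row:
  assumes "set_pmf w \<subseteq> {1..n}"
  shows "measure_pmf.expectation (row_pmf w n) (character n S) = mean_char w n S"
proof -
  have ne: "{v \<in> binary_vectors n. weight n v = k} \<noteq> {}" if "k \<in> {1..n}" for k
  proof -
    have "card {v \<in> binary_vectors n. weight n v = k} > 0" using that by (simp add: card_weight)
    then show ?thesis by (metis card.empty less_numeral_extra(3))
  qed
  \<comment> \<open>For \<open>k > n\<close> there are no vectors of weight \<open>k\<close>.
    Outside \<open>{1..n}\<close>, which \<open>w\<close> does not charge, a point mass is
    substituted.\<close>
  have eq: "row_pmf w n = bind_pmf w (\<lambda>k. if k \<in> {1..n} then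
      pmf_of_set {v \<in> binary_vectors n. weight n v = k} else return_pmf undefined)"
    unfolding row_pmf_def using assms by (intro bind_pmf_cong) auto
  have "measure_pmf.expectation (row_pmf w n) (character n S)
      = (\<Sum>k\<in>{1..n}. pmf w k *\<^sub>R measure_pmf.expectation (if k \<in> {1..n} then
      pmf_of_set {v \<in> binary_vectors n. weight n v = k} else return_pmf undefined) (character n S))"
    unfolding eq using assms
    by (intro pmf_expectation_bind) (auto simp: set_pmf_of_set[OF ne])
  also have "\<dots> = (\<Sum>k\<in>{1..n}. pmf w k *\<^sub>R krawtchouk n S k)"
    using ne
    by (intro sum.cong refl)
      (simp add: integral_pmf_of_set sum_character_weight card_weight krawtchouk_def)
  also have "\<dots> = mean_char w n S"
    unfolding mean_char_def using assms by (intro integral_measure_pmf[symmetric]) auto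
  finally show ?thesis .
qed

text \<open>A mean of values \<open>-1\<close> and \<open>1\<close>. For \<open>k > n\<close> the
  quotient has denominator 0 and is therefore 0.\<close>

lemma abs_krawtchouk_le_1: "\<bar>krawtchouk n S k\<bar> \<le> 1"
proof -
  have "\<bar>elem_sym (sign_of S) n k\<bar> \<le> (\<Sum>v | v \<in> binary_vectors n \<and> weight n v = k. \<bar>character n S v\<bar>)"
    unfolding sum_character_weight[symmetric] by (rule sum_abs)
  also have "\<dots> \<le> (\<Sum>v | v \<in> binary_vectors n \<and> weight n v = k. 1)"
  proof (rule sum_mono)
    fix v show "\<bar>character n S v\<bar> \<le> 1"
      using character_eq_1_or_minus_1[of n S v] by auto
  qed
  also have "\<dots> = real (n choose k)" by (simp add: card_weight)
  finally show ?thesis by (auto simp: krawtchouk_def divide_le_eq_1)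
qed

lemma integrable_krawtchouk: "integrable (measure_pmf w) (krawtchouk n S)"
  by (rule measure_pmf.integrable_const_bound[where B = 1]) (auto simp: abs_krawtchouk_le_1)

lemma abs_mean_char_le_1: "\<bar>mean_char w n S\<bar> \<le> 1"
proof -
  have "\<bar>mean_char w n S\<bar> \<le> measure_pmf.expectation w (\<lambda>k. \<bar>krawtchouk n S k\<bar>)"
    unfolding mean_char_def by (rule integral_abs_bound)
  also have "\<dots> \<le> measure_pmf.expectation w (\<lambda>k. 1)"
    by (intro integral_mono integrable_abs integrable_krawtchouk) (auto simp: abs_krawtchouk_le_1)
  finally show ?thesis by simp
qed

lemma expected_null_count_eq:
  assumes "set_pmf w \<subseteq> {1..n}"
  shows "expected_null_count w n m = (\<Sum>S\<in>Pow {..<n}. (1 + mean_char w n S) ^ m) / 2 ^ n"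
proof -
  have int: "integrable (measure_pmf (row_pmf w n)) f" for f :: "_ \<Rightarrow> real"
    by (intro integrable_measure_pmf_finite finite_set_pmf_row assms)
  have fin: "finite (set_pmf (matrix_pmf w n m))"
    unfolding matrix_pmf_def using finite_set_pmf_row[OF assms]
    by (subst set_Pi_pmf) (auto intro!: finite_PiE_dflt)
  have "2 ^ n * expected_null_count w n m = measure_pmf.expectation (matrix_pmf w n m)
      (\<lambda>M. 2 ^ n * real (null_count n m M))"
    by (simp add: expected_null_count_def)
  also have "\<dots> = (\<Sum>S\<in>Pow {..<n}. measure_pmf.expectation (matrix_pmf w n m)
      (\<lambda>M. \<Prod>i<m. 1 + character n S (M i)))"
    unfolding null_count_eq
    by (rule Bochner_Integration.integral_sum) (intro integrable_measure_pmf_finite fin)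
  \<comment> \<open>Independence of the rows; the product rule used here asks for nonnegative
    factors, and \<open>1 + character n S v\<close> is 0 or 2.\<close>
  also have "\<dots> = (\<Sum>S\<in>Pow {..<n}. \<Prod>i<m. measure_pmf.expectation (row_pmf w n)
      (\<lambda>v. 1 + character n S v))"
    unfolding matrix_pmf_def
  proof (intro sum.cong refl expectation_prod_Pi_pmf int)
    fix S v show "0 \<le> 1 + character n S v" using character_eq_1_or_minus_1[of n S v] by auto
  qed simp
  also have "\<dots> = (\<Sum>S\<in>Pow {..<n}. (1 + mean_char w n S) ^ m)"
    by (simp add: int expectation_character_row[OF assms])
  finally show ?thesis by (simp add: field_simps)
qed

text \<open>Rows of positive weight are nonzero vectors, so their characters sum to 0 over
  \<open>S\<close>. This removes the first-order term when the expectation is expanded.\<close>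

lemma sum_mean_char:
  assumes "set_pmf w \<subseteq> {1..n}"
  shows "(\<Sum>S\<in>Pow {..<n}. mean_char w n S) = 0"
proof -
  have zero: "(\<Sum>S\<in>Pow {..<n}. krawtchouk n S k) = 0" if k: "k \<in> {1..n}" for k
  proof -
    have "(\<Sum>S\<in>Pow {..<n}. elem_sym (sign_of S) n k)
      = (\<Sum>v | v \<in> binary_vectors n \<and> weight n v = k. \<Sum>S\<in>Pow {..<n}. character n S v)"
      unfolding sum_character_weight[symmetric] by (rule sum.swap)
    also have "\<dots> = 0"
    proof (rule sum.neutral, safe)
      fix v assume v: "v \<in> binary_vectors n" "k = weight n v"
      then have "weight n v > 0" using k by auto
      then have "{j \<in> {..<n}. v j = 1} \<noteq> {}"
        unfolding weight_def by (metis card.empty less_numeral_extra(3))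
      then have "\<not> (\<forall>j<n. even (v j))" by fastforce
      then show "(\<Sum>S\<in>Pow {..<n}. character n S v) = 0" by (simp only: sum_characters if_False)
    qed
    finally show ?thesis by (simp add: krawtchouk_def sum_divide_distrib[symmetric])
  qed
  have "mean_char w n S = (\<Sum>k\<in>{1..n}. pmf w k * krawtchouk n S k)" for S
    unfolding mean_char_def using assms
    by (subst integral_measure_pmf[of "{1..n}"]) auto
  then have "(\<Sum>S\<in>Pow {..<n}. mean_char w n S)
      = (\<Sum>k\<in>{1..n}. pmf w k * (\<Sum>S\<in>Pow {..<n}. krawtchouk n S k))"
    by (simp add: sum_distrib_left) (rule sum.swap)
  then show ?thesis using zero by simp
qed

section \<open>Krawtchouk values\<close>

text \<open>With \<open>s\<close> the modulus of the sum of the signs, the base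
  \<open>b = s + sqrt n\<close> satisfies \<open>s * b + n <= b * b\<close>, so the bound
  \<open>b ^ w\<close> propagates through the three-term recurrence; the division by
  \<open>w + 2\<close> only improves it.\<close>

lemma abs_elem_sym_le:
  assumes e: "\<And>i. e i ^ 2 = 1" and "w \<le> n"
  shows "\<bar>elem_sym e n w\<bar> \<le> (\<bar>\<Sum>i<n. e i\<bar> + sqrt n) ^ w"
  using \<open>w \<le> n\<close>
proof (induction w rule: induct_nat_012)
  case 1
  then show ?case by (simp add: elem_sym_one)
next
  case (ge2 w)
  define s where "s = \<bar>\<Sum>i<n. e i\<bar>"
  define b where "b = s + sqrt n"
  have nn: "s \<ge> 0" "b \<ge> 0" by (simp_all add: s_def b_def)
  have "real n = sqrt n * sqrt n" by simp
  then have sq: "s * b + real n \<le> b * b"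
    using nn(1) unfolding b_def by (simp add: algebra_simps)
  have "(real w + 2) * \<bar>elem_sym e n (Suc (Suc w))\<bar> = \<bar>(real w + 2) * elem_sym e n (Suc (Suc w))\<bar>"
    by (simp add: abs_mult)
  also have "\<dots> = \<bar>(\<Sum>i<n. e i) * elem_sym e n (Suc w) - (real n - real w) * elem_sym e n w\<bar>"
    unfolding elem_sym_recurrence[OF e] ..
  also have "\<dots> \<le> s * \<bar>elem_sym e n (Suc w)\<bar> + (real n - real w) * \<bar>elem_sym e n w\<bar>"
    using ge2.prems unfolding s_def
    by (intro order_trans[OF abs_triangle_ineq4]) (simp add: abs_mult)
  also have "\<dots> \<le> s * b ^ Suc w + real n * b ^ w"
    using ge2 nn by (intro add_mono mult_mono) (auto simp: b_def s_def)
  also have "\<dots> = (s * b + real n) * b ^ w" by (simp add: algebra_simps)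
  also have "\<dots> \<le> (b * b) * b ^ w" using sq nn by (intro mult_right_mono) auto
  also have "\<dots> = 1 * b ^ Suc (Suc w)" by simp
  also have "\<dots> \<le> (real w + 2) * b ^ Suc (Suc w)" using nn by (intro mult_right_mono) auto
  finally show ?case by (simp add: b_def s_def)
qed simp

text \<open>The average of the signs of \<open>S\<close>, hence the point of [-1,1] at which the
  generating function is compared with \<open>mean_char\<close>.\<close>

definition bias :: "nat \<Rightarrow> nat set \<Rightarrow> real" where
  "bias n S = 1 - 2 * (real (card S) / real n)"

lemma sum_sign_of_bias: "S \<subseteq> {..<n} \<Longrightarrow> (\<Sum>i<n. sign_of S i) = real n * bias n S"
  by (cases "n = 0") (simp_all add: sum_sign_of bias_def right_diff_distrib)

lemma card_subset_le: "S \<subseteq> {..<n} \<Longrightarrow> card S \<le> n"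
  using card_mono[of "{..<n}" S] by simp

lemma abs_bias_le_1: "S \<subseteq> {..<n} \<Longrightarrow> \<bar>bias n S\<bar> \<le> 1"
  using card_subset_le[of S n] by (cases "n = 0") (auto simp: bias_def abs_le_iff divide_le_eq)

text \<open>The base in \<open>abs_elem_sym_le\<close> is \<open>n * u\<close> with \<open>u\<close>
  the sum in parentheses; dividing by the binomial coefficient, which is at least
  \<open>(n / w) ^ w\<close>, turns \<open>n\<close> into \<open>w\<close>.\<close>

lemma abs_krawtchouk_le:
  assumes "S \<subseteq> {..<n}" "w \<le> n" "n \<ge> 1"
  shows "\<bar>krawtchouk n S w\<bar> \<le> (real w * (\<bar>bias n S\<bar> + 1 / sqrt n)) ^ w"
proof -
  define u where "u = \<bar>bias n S\<bar> + 1 / sqrt n"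
  have "sqrt n * sqrt n = real n" by simp
  then have nu: "\<bar>\<Sum>i<n. sign_of S i\<bar> + sqrt n = real n * u"
    using assms by (simp add: u_def sum_sign_of_bias abs_mult field_simps)
  have "u \<ge> 0" by (simp add: u_def)
  have "\<bar>elem_sym (sign_of S) n w\<bar> \<le> (real n * u) ^ w"
    using abs_elem_sym_le[of "sign_of S" w n] assms nu by simp
  also have "(real n * u) ^ w \<le> (real w * u) ^ w * real (n choose w)"
  proof (cases "w = 0")
    case False
    have "(real n * u) ^ w = (real w * u) ^ w * (real n / real w) ^ w"
      using False by (simp add: power_mult_distrib power_divide)
    also have "\<dots> \<le> (real w * u) ^ w * real (n choose w)"
      using binomial_ge_n_over_k_pow_k[of w n] assms \<open>u \<ge> 0\<close>
      by (intro mult_left_mono) auto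
    finally show ?thesis .
  qed simp
  finally show ?thesis
    using assms by (simp add: krawtchouk_def u_def divide_le_eq abs_divide)
qed

text \<open>The least weight \<open>r0\<close> dictates the order of vanishing: a weight
  \<open>k\<close> gives \<open>u ^ k\<close>, whose surplus \<open>u ^ (k - r0)\<close> is at most
  \<open>2 ^ r1\<close> since \<open>u <= 2\<close>.\<close>

lemma abs_mean_char_le:
  assumes "S \<subseteq> {..<n}" "n \<ge> 1" "set_pmf w \<subseteq> {1..n}" "set_pmf w \<subseteq> {r0..r1}"
  shows "\<bar>mean_char w n S\<bar> \<le> (2 * real r1) ^ r1 * (\<bar>bias n S\<bar> + 1 / sqrt n) ^ r0"
proof -
  define u where "u = \<bar>bias n S\<bar> + 1 / sqrt n"
  have u: "0 \<le> u" "u \<le> 2"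
    using add_mono[OF abs_bias_le_1[OF assms(1)], of "1 / sqrt n" 1] assms(2)
    by (auto simp: u_def)
  have bd: "\<bar>krawtchouk n S k\<bar> \<le> (2 * real r1) ^ r1 * u ^ r0" if k: "k \<in> set_pmf w" for k
  proof -
    have k': "1 \<le> k" "k \<le> n" "r0 \<le> k" "k \<le> r1" using k assms by auto
    have "\<bar>krawtchouk n S k\<bar> \<le> (real k * u) ^ k" using abs_krawtchouk_le assms k' by (simp add: u_def)
    also have "\<dots> = real k ^ k * (u ^ (k - r0) * u ^ r0)"
      using k' by (simp add: power_mult_distrib power_add[symmetric])
    also have "\<dots> \<le> real r1 ^ r1 * (2 ^ r1 * u ^ r0)"
    proof (intro mult_mono)
      have "real k ^ k \<le> real r1 ^ k" using k' by (intro power_mono) auto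
      also have "\<dots> \<le> real r1 ^ r1" using k' by (intro power_increasing) auto
      finally show "real k ^ k \<le> real r1 ^ r1" .
      have "u ^ (k - r0) \<le> 2 ^ (k - r0)" using u by (intro power_mono) auto
      also have "\<dots> \<le> 2 ^ r1" using k' by (intro power_increasing) auto
      finally show "u ^ (k - r0) \<le> 2 ^ r1" .
    qed (use u in auto)
    finally show ?thesis by (simp add: power_mult_distrib mult_ac)
  qed
  have "\<bar>mean_char w n S\<bar> \<le> measure_pmf.expectation w (\<lambda>k. \<bar>krawtchouk n S k\<bar>)"
    unfolding mean_char_def by (rule integral_abs_bound)
  also have "\<dots> \<le> measure_pmf.expectation w (\<lambda>k. (2 * real r1) ^ r1 * u ^ r0)"
    using bd by (intro integral_mono_AE integrable_abs integrable_krawtchouk) (auto simp: AE_measure_pmf_iff)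
  finally show ?thesis by (simp add: u_def)
qed

text \<open>\<open>elem_sym_recurrence\<close> after normalisation: \<open>c1\<close> and
  \<open>c2\<close> express both outer binomial coefficients through the middle one, which then
  cancels.\<close>

lemma krawtchouk_recurrence:
  assumes "S \<subseteq> {..<n}" "w + 2 \<le> n"
  shows "(real n - real w - 1) * krawtchouk n S (Suc (Suc w))
    = real n * bias n S * krawtchouk n S (Suc w) - (real w + 1) * krawtchouk n S w"
proof -
  have c1: "(real w + 2) * real (n choose Suc (Suc w)) = (real n - real w - 1) * real (n choose Suc w)"
  proof -
    have "Suc (Suc w) * (n choose Suc (Suc w)) = (n - Suc w) * (n choose Suc w)"
      by (metis binomial_absorb_comp binomial_absorption)
    then have "real (Suc (Suc w)) * real (n choose Suc (Suc w)) = real (n - Suc w) * real (n choose Suc w)"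
      by (metis of_nat_mult)
    then show ?thesis using assms by (simp add: of_nat_diff algebra_simps)
  qed
  have c2: "(real w + 1) * real (n choose Suc w) = (real n - real w) * real (n choose w)"
  proof -
    have "Suc w * (n choose Suc w) = (n - w) * (n choose w)"
      by (metis binomial_absorb_comp binomial_absorption)
    then have "real (Suc w) * real (n choose Suc w) = real (n - w) * real (n choose w)"
      by (metis of_nat_mult)
    then show ?thesis using assms by (simp add: of_nat_diff algebra_simps)
  qed
  have pos: "real (n choose w) > 0" "real (n choose Suc w) > 0" "real (n choose Suc (Suc w)) > 0"
    using assms by auto
  have e: "elem_sym (sign_of S) n k = real (n choose k) * krawtchouk n S k" if "k \<le> n" for k
    using that by (simp add: krawtchouk_def)
  have "real (n choose Suc w) * ((real n - real w - 1) * krawtchouk n S (Suc (Suc w)))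
      = (real w + 2) * elem_sym (sign_of S) n (Suc (Suc w))"
    using assms c1 by (simp add: e)
  also have "\<dots> = real n * bias n S * elem_sym (sign_of S) n (Suc w) - (real n - real w) * elem_sym (sign_of S) n w"
    using elem_sym_recurrence[of "sign_of S" w n] assms by (simp add: sum_sign_of_bias)
  also have "\<dots> = real (n choose Suc w) * (real n * bias n S * krawtchouk n S (Suc w) - (real w + 1) * krawtchouk n S w)"
  proof -
    have "(real n - real w) * (real (n choose w) * krawtchouk n S w)
        = ((real n - real w) * real (n choose w)) * krawtchouk n S w" by simp
    also have "\<dots> = (real w + 1) * real (n choose Suc w) * krawtchouk n S w" by (simp only: c2)
    finally show ?thesis using assms by (simp add: e algebra_simps)
  qed
  finally show ?thesis using pos by simp
qed

text \<open>For \<open>w\<close> small against \<open>n\<close> the recurrence is nearly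
  \<open>krawtchouk n S (w + 2) = x * krawtchouk n S (w + 1)\<close>, whose solution is
  \<open>x ^ w\<close>. Each step adds an error of at most \<open>2 * K / (n - K)\<close>, and
  \<open>\<bar>x\<bar> \<le> 1\<close> keeps earlier errors from growing.\<close>

lemma krawtchouk_approx:
  assumes S: "S \<subseteq> {..<n}" and "K < n" "w \<le> K"
  shows "\<bar>krawtchouk n S w - bias n S ^ w\<bar> \<le> 2 * real K * real w / (real n - real K)"
  using \<open>w \<le> K\<close>
proof (induction w rule: induct_nat_012)
  case 0
  then show ?case by (simp add: krawtchouk_def)
next
  case 1
  have "krawtchouk n S (Suc 0) = bias n S"
    using assms by (simp add: krawtchouk_def elem_sym_one sum_sign_of_bias)
  then show ?case using assms by simp
next
  case (ge2 w)
  define x where "x = bias n S"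
  define N where "N = real n - real w - 1"
  have x1: "\<bar>x\<bar> \<le> 1" using abs_bias_le_1[OF S] by (simp add: x_def)
  have Npos: "N > 0" "N \<ge> real n - real K" using ge2.prems assms by (auto simp: N_def)
  have "N * krawtchouk n S (Suc (Suc w)) = real n * x * krawtchouk n S (Suc w) - (real w + 1) * krawtchouk n S w"
    using krawtchouk_recurrence[OF S, of w] ge2.prems assms by (simp add: x_def N_def)
  \<comment> \<open>Uses \<open>n = N + (w + 1)\<close> to isolate the deviation from the geometric
    recurrence.\<close>
  then have eq: "N * (krawtchouk n S (Suc (Suc w)) - x * krawtchouk n S (Suc w))
      = (real w + 1) * (x * krawtchouk n S (Suc w) - krawtchouk n S w)"
    by (simp add: N_def algebra_simps)
  have "\<bar>x * krawtchouk n S (Suc w) - krawtchouk n S w\<bar> \<le> \<bar>x\<bar> * \<bar>krawtchouk n S (Suc w)\<bar> + \<bar>krawtchouk n S w\<bar>"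
    by (intro order_trans[OF abs_triangle_ineq4]) (simp add: abs_mult)
  also have "\<dots> \<le> 1 * 1 + 1"
    using x1 by (intro add_mono mult_mono abs_krawtchouk_le_1) auto
  finally have "N * \<bar>krawtchouk n S (Suc (Suc w)) - x * krawtchouk n S (Suc w)\<bar> \<le> (real w + 1) * 2"
    using arg_cong[OF eq, of abs] Npos
    by (simp only: abs_mult abs_of_pos mult_left_mono)
  then have "\<bar>krawtchouk n S (Suc (Suc w)) - x * krawtchouk n S (Suc w)\<bar> \<le> (real w + 1) * 2 / N"
    using Npos by (simp add: field_simps)
  also have "\<dots> \<le> real K * 2 / (real n - real K)"
    using Npos assms ge2.prems by (intro frac_le) auto
  finally have 1: "\<bar>krawtchouk n S (Suc (Suc w)) - x * krawtchouk n S (Suc w)\<bar> \<le> 2 * real K / (real n - real K)"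
    by (simp only: mult.commute)
  have "\<bar>x * krawtchouk n S (Suc w) - x * x ^ Suc w\<bar> = \<bar>x\<bar> * \<bar>krawtchouk n S (Suc w) - x ^ Suc w\<bar>"
    by (simp add: abs_mult right_diff_distrib[symmetric])
  also have "\<dots> \<le> 1 * (2 * real K * real (Suc w) / (real n - real K))"
    using x1 ge2 unfolding x_def by (intro mult_mono) auto
  finally have 2: "\<bar>x * krawtchouk n S (Suc w) - x * x ^ Suc w\<bar> \<le> 2 * real K * real (Suc w) / (real n - real K)"
    by simp
  have "\<bar>krawtchouk n S (Suc (Suc w)) - x ^ Suc (Suc w)\<bar>
      \<le> 2 * real K / (real n - real K) + 2 * real K * real (Suc w) / (real n - real K)"
    using 1 2 unfolding power_Suc by linarith
  also have "\<dots> = 2 * real K * real (Suc (Suc w)) / (real n - real K)"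
    by (simp add: add_divide_distrib[symmetric] algebra_simps)
  finally show ?case by (simp add: x_def)
qed

section \<open>Convergence of the mean characters\<close>

text \<open>Truncation at \<open>K\<close>: the head is compared term by term, and each tail costs
  at most its mass because the integrands are bounded by 1.\<close>

lemma expectation_diff_le:
  fixes f g :: "nat \<Rightarrow> real"
  assumes f: "\<And>k. \<bar>f k\<bar> \<le> 1" and g: "\<And>k. \<bar>g k\<bar> \<le> 1"
  shows "\<bar>measure_pmf.expectation w f - measure_pmf.expectation v g\<bar>
    \<le> (\<Sum>k\<le>K. \<bar>pmf w k - pmf v k\<bar> + \<bar>f k - g k\<bar>)
      + (1 - measure_pmf.prob w {..K}) + (1 - measure_pmf.prob v {..K})"
proof -
  have split: "\<bar>measure_pmf.expectation p h - (\<Sum>k\<le>K. pmf p k * h k)\<bar> \<le> 1 - measure_pmf.prob p {..K}"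
    if h: "\<And>k. \<bar>h k\<bar> \<le> 1" for p and h :: "nat \<Rightarrow> real"
  proof -
    have int: "integrable (measure_pmf p) h'" if "\<And>k. \<bar>h' k\<bar> \<le> 1" for h' :: "nat \<Rightarrow> real"
      by (rule measure_pmf.integrable_const_bound[where B = 1]) (use that in auto)
    have "(\<Sum>k\<le>K. pmf p k * h k) = measure_pmf.expectation p (\<lambda>k. h k * indicator {..K} k)"
      by (subst integral_measure_pmf[of "{..K}"]) (auto simp: indicator_def split: if_splits)
    then have "measure_pmf.expectation p h - (\<Sum>k\<le>K. pmf p k * h k)
        = measure_pmf.expectation p (\<lambda>k. h k - h k * indicator {..K} k)"
      using h by (subst Bochner_Integration.integral_diff) (auto intro!: int simp: indicator_def)
    also have "\<bar>\<dots>\<bar> \<le> measure_pmf.expectation p (\<lambda>k. \<bar>h k - h k * indicator {..K} k\<bar>)"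
      by (rule integral_abs_bound)
    also have "\<dots> \<le> measure_pmf.expectation p (indicator (- {..K}))"
      using h by (intro integral_mono int) (auto simp: indicator_def)
    also have "\<dots> = 1 - measure_pmf.prob p {..K}"
      using measure_pmf.prob_compl[of "{..K}" p] by (simp add: Compl_eq_Diff_UNIV)
    finally show ?thesis .
  qed
  have "\<bar>(\<Sum>k\<le>K. pmf w k * f k) - (\<Sum>k\<le>K. pmf v k * g k)\<bar>
      \<le> (\<Sum>k\<le>K. \<bar>pmf w k * f k - pmf v k * g k\<bar>)"
    by (simp add: sum_subtractf[symmetric] sum_abs)
  also have "\<dots> \<le> (\<Sum>k\<le>K. \<bar>pmf w k - pmf v k\<bar> + \<bar>f k - g k\<bar>)"
  proof (rule sum_mono)
    fix k
    have "pmf w k * f k - pmf v k * g k = (pmf w k - pmf v k) * f k + pmf v k * (f k - g k)"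
      by (simp add: algebra_simps)
    also have "\<bar>\<dots>\<bar> \<le> \<bar>pmf w k - pmf v k\<bar> * \<bar>f k\<bar> + pmf v k * \<bar>f k - g k\<bar>"
      by (intro order_trans[OF abs_triangle_ineq]) (simp add: abs_mult)
    also have "\<dots> \<le> \<bar>pmf w k - pmf v k\<bar> * 1 + 1 * \<bar>f k - g k\<bar>"
      using f by (intro add_mono mult_mono) (auto simp: pmf_le_1)
    finally show "\<bar>pmf w k * f k - pmf v k * g k\<bar> \<le> \<bar>pmf w k - pmf v k\<bar> + \<bar>f k - g k\<bar>" by simp
  qed
  finally show ?thesis using split[of f w, OF f] split[of g v, OF g] by linarith
qed

lemma converges_prob_atMost:
  assumes "converges_in_distribution Wn W"
  shows "(\<lambda>n. measure_pmf.prob (Wn n) {..k}) \<longlonglongrightarrow> measure_pmf.prob W {..k}"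
proof -
  \<comment> \<open>A half-integer carries no mass of an integer-valued law, so it is a continuity
    point of the limiting distribution function, whose value there is the probability of
    \<open>{..k}\<close>.\<close>
  define t where "t = real k + 1 / 2"
  have le: "real j \<le> t \<longleftrightarrow> j \<le> k" for j unfolding t_def by linarith
  have cdf: "cdf (distr (measure_pmf p) borel real) t = measure_pmf.prob p {..k}" for p
    unfolding cdf_def by (subst measure_distr) (auto simp: le intro!: arg_cong[where f = "measure_pmf.prob p"])
  interpret real_distribution "distr (measure_pmf W) borel real"
    by (intro prob_space.real_distribution_distr measure_pmf.prob_space_axioms) auto
  have "real j \<noteq> t" for j
  proof
    assume "real j = t"
    then have "2 * real j = real (2 * k + 1)" by (simp add: t_def)
    then have "2 * j = 2 * k + 1" by linarith
    then show False by presburger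
  qed
  then have "measure (distr (measure_pmf W) borel real) {t} = 0"
    by (subst measure_distr) (auto simp: vimage_def)
  then have "isCont (cdf (distr (measure_pmf W) borel real)) t" by (simp add: isCont_cdf)
  then show ?thesis
    using assms unfolding converges_in_distribution_def weak_conv_m_def weak_conv_def
    by (auto simp: cdf dest!: spec[of _ t])
qed

lemma converges_pmf:
  assumes "converges_in_distribution Wn W"
  shows "(\<lambda>n. pmf (Wn n) k) \<longlonglongrightarrow> pmf W k"
proof (cases k)
  case 0
  have "{..0::nat} = {0}" by auto
  then show ?thesis using converges_prob_atMost[OF assms, of 0] 0 by (simp add: measure_pmf_single)
next
  case (Suc j)
  have "pmf p k = measure_pmf.prob p {..k} - measure_pmf.prob p {..j}" for p
  proof -
    have "measure_pmf.prob p {..k} = measure_pmf.prob p {..j} + measure_pmf.prob p {k}"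
      unfolding Suc atMost_Suc
      by (subst measure_pmf.finite_measure_Union[symmetric]) auto
    then show ?thesis by (simp add: measure_pmf_single)
  qed
  then show ?thesis using converges_prob_atMost[OF assms] by (auto intro!: tendsto_diff)
qed

lemma prob_atMost_tendsto_1: "(\<lambda>k. measure_pmf.prob W {..k::nat}) \<longlonglongrightarrow> 1"
proof -
  have "(\<lambda>k. measure_pmf.prob W {..k}) \<longlonglongrightarrow> measure_pmf.prob W (\<Union>k. {..k})"
    by (rule measure_pmf.finite_Lim_measure_incseq) (auto simp: incseq_def)
  moreover have "(\<Union>k. {..k::nat}) = UNIV" by auto
  ultimately show ?thesis by simp
qed

text \<open>Uniformity in \<open>S\<close> holds because both the cutoff \<open>K\<close> and the
  bound \<open>B n\<close> are independent of \<open>S\<close>.\<close>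

lemma mean_char_uniform:
  assumes conv: "converges_in_distribution Wn W" and "e > 0"
  shows "\<forall>\<^sub>F n in sequentially. \<forall>S. S \<subseteq> {..<n} \<longrightarrow>
    \<bar>mean_char (Wn n) n S - gen_fun W (bias n S)\<bar> < e"
proof -
  \<comment> \<open>In the limit of \<open>B\<close> the tail of \<open>W\<close> appears twice,
    once as the limit of the tails of \<open>Wn n\<close>; hence \<open>e / 2\<close>.\<close>
  have "\<forall>\<^sub>F K in sequentially. measure_pmf.prob W {..K} > 1 - e / 2"
    using \<open>e > 0\<close> by (intro order_tendstoD(1)[OF prob_atMost_tendsto_1]) auto
  then obtain K where K: "measure_pmf.prob W {..K} > 1 - e / 2"
    by (auto simp: eventually_sequentially)
  define B where "B n = (\<Sum>k\<le>K. \<bar>pmf (Wn n) k - pmf W k\<bar> + 2 * real K * real k / (real n - real K))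
      + (1 - measure_pmf.prob (Wn n) {..K}) + (1 - measure_pmf.prob W {..K})" for n
  have lim: "(\<lambda>n. c / (real n - real K)) \<longlonglongrightarrow> 0" for c by real_asymp
  have "B \<longlonglongrightarrow> (\<Sum>k\<le>K. \<bar>pmf W k - pmf W k\<bar> + 0) + (1 - measure_pmf.prob W {..K})
      + (1 - measure_pmf.prob W {..K})"
    unfolding B_def
    by (intro tendsto_add tendsto_sum tendsto_diff tendsto_rabs tendsto_const lim
        converges_pmf[OF conv] converges_prob_atMost[OF conv])
  moreover have "(\<Sum>k\<le>K. \<bar>pmf W k - pmf W k\<bar> + 0) + (1 - measure_pmf.prob W {..K})
      + (1 - measure_pmf.prob W {..K}) < e" using K by simp
  ultimately have "\<forall>\<^sub>F n in sequentially. B n < e" by (rule order_tendstoD(2))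
  then show ?thesis using eventually_gt_at_top[of K]
  proof eventually_elim
    case (elim n)
    show ?case
    proof (intro allI impI)
      fix S assume S: "S \<subseteq> {..<n}"
      have "\<bar>mean_char (Wn n) n S - gen_fun W (bias n S)\<bar>
        \<le> (\<Sum>k\<le>K. \<bar>pmf (Wn n) k - pmf W k\<bar> + \<bar>krawtchouk n S k - bias n S ^ k\<bar>)
      + (1 - measure_pmf.prob (Wn n) {..K}) + (1 - measure_pmf.prob W {..K})"
        unfolding mean_char_def gen_fun_def using abs_bias_le_1[OF S]
        by (intro expectation_diff_le abs_krawtchouk_le_1) (simp add: power_abs power_le_one)
      also have "\<dots> \<le> B n"
        unfolding B_def using krawtchouk_approx[OF S elim(2)]
        by (intro add_mono sum_mono order_refl) auto
      finally show "\<bar>mean_char (Wn n) n S - gen_fun W (bias n S)\<bar> < e" using elim(1) by linarith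
    qed
  qed
qed

text \<open>Allows a negative bias to be folded onto its modulus, which is why the supremum in
  \<open>F_rho\<close> over \<open>\<gamma> \<le> 1/2\<close> suffices.\<close>

lemma abs_gen_fun_le:
  assumes "\<bar>s\<bar> \<le> 1"
  shows "\<bar>gen_fun W s\<bar> \<le> gen_fun W \<bar>s\<bar>" "0 \<le> gen_fun W \<bar>s\<bar>" "gen_fun W \<bar>s\<bar> \<le> 1"
proof -
  have int: "integrable (measure_pmf W) (\<lambda>k. \<bar>s\<bar> ^ k)"
    by (rule measure_pmf.integrable_const_bound[where B = 1]) (use assms in \<open>auto simp: power_le_one\<close>)
  show "\<bar>gen_fun W s\<bar> \<le> gen_fun W \<bar>s\<bar>"
    unfolding gen_fun_def power_abs[symmetric] by (rule integral_abs_bound)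
  show "0 \<le> gen_fun W \<bar>s\<bar>" unfolding gen_fun_def by simp
  have "gen_fun W \<bar>s\<bar> \<le> measure_pmf.expectation W (\<lambda>k. 1)"
    unfolding gen_fun_def by (intro integral_mono int) (use assms in \<open>auto simp: power_le_one\<close>)
  then show "gen_fun W \<bar>s\<bar> \<le> 1" by simp
qed

lemma gen_fun_bounds: "0 \<le> s \<Longrightarrow> s \<le> 1 \<Longrightarrow> 0 \<le> gen_fun W s \<and> gen_fun W s \<le> 1"
  using abs_gen_fun_le[of s W] by auto

lemma gen_fun_0: "set_pmf W \<subseteq> {1..} \<Longrightarrow> gen_fun W 0 = 0"
proof -
  assume W: "set_pmf W \<subseteq> {1..}"
  have "gen_fun W 0 = measure_pmf.expectation W (\<lambda>k. 0)"
    unfolding gen_fun_def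
    by (rule integral_cong_AE) (use W in \<open>auto simp: AE_measure_pmf_iff zero_power\<close>)
  then show ?thesis by simp
qed

lemma continuous_on_gen_fun: "continuous_on {-1..1} (gen_fun W)"
  unfolding gen_fun_def[abs_def]
proof (rule continuous_on_LINT_pmf)
  fix i and a :: real assume "a \<in> {-1..1}"
  then show "norm (a ^ i) \<le> 1" by (auto simp: power_abs power_le_one)
qed (auto intro!: continuous_intros)

section \<open>Entropy and Gaussian bounds\<close>

text \<open>Binary entropy in natural logarithms. At 0 and 1 the factor 0 kills the logarithm,
  matching the convention of \<open>pow0\<close>.\<close>

definition entropy :: "real \<Rightarrow> real" where
  "entropy g = - (g * ln g) - (1 - g) * ln (1 - g)"

lemma pow0_self: "g \<ge> 0 \<Longrightarrow> pow0 g g = exp (g * ln g)"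
  by (auto simp: pow0_def powr_def)

lemma pow0_entropy:
  assumes "0 \<le> g" "g \<le> 1"
  shows "1 / (2 * pow0 g g * pow0 (1 - g) (1 - g)) = exp (entropy g - ln 2)"
proof -
  define a b where "a = g * ln g" and "b = (1 - g) * ln (1 - g)"
  have eqs: "pow0 g g = exp a" "pow0 (1 - g) (1 - g) = exp b" "entropy g = - a - b"
    using assms by (simp_all add: pow0_self a_def b_def entropy_def)
  show ?thesis unfolding eqs exp_diff exp_minus by (simp add: field_simps)
qed

lemma entropy_sym: "entropy (1 - g) = entropy g"
  by (simp add: entropy_def)

section \<open>Binomial coefficients against entropy\<close>

lemma power_self_exp: "real k ^ k = exp (real k * ln (real k))"
  by (cases "k = 0") (simp_all add: exp_of_nat_mult)

text \<open>Stated without division so that \<open>k = 0\<close> and \<open>k = n\<close> are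
  included. The right-hand side is what the binomial theorem gives for
  \<open>(k + (n - k)) ^ n\<close>.\<close>

lemma exp_entropy_eq:
  assumes "k \<le> n" "n \<ge> 1"
  shows "real (k ^ k * (n - k) ^ (n - k)) * exp (real n * entropy (real k / real n)) = real (n ^ n)"
proof -
  define a b where "a = real k" and "b = real (n - k)"
  have n: "real n = a + b" using assms by (simp add: a_def b_def)
  have nn: "a \<ge> 0" "b \<ge> 0" "a + b > 0" using assms n by (auto simp: a_def b_def)
  have 1: "a * ln (a / (a + b)) = a * ln a - a * ln (a + b)"
    using nn by (cases "a = 0") (simp_all add: ln_div algebra_simps)
  have 2: "b * ln (b / (a + b)) = b * ln b - b * ln (a + b)"
    using nn by (cases "b = 0") (simp_all add: ln_div algebra_simps)
  have "1 - a / (a + b) = b / (a + b)" using nn by (simp add: field_simps)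
  then have "(a + b) * entropy (a / (a + b)) = - (a * ln (a / (a + b))) - b * ln (b / (a + b))"
    using nn by (simp add: entropy_def right_diff_distrib)
  also have "\<dots> = (a + b) * ln (a + b) - a * ln a - b * ln b"
    unfolding 1 2 by (simp add: algebra_simps)
  finally have E: "exp (real n * entropy (a / real n))
      = exp (real n * ln (real n)) / (exp (a * ln a) * exp (b * ln b))"
    by (simp add: n a_def[symmetric] exp_diff)
  have pw: "a ^ k = exp (a * ln a)" "b ^ (n - k) = exp (b * ln b)"
    "real n ^ n = exp (real n * ln (real n))"
    unfolding a_def b_def by (rule power_self_exp)+
  show ?thesis
    unfolding E of_nat_mult of_nat_power pw a_def[symmetric] b_def[symmetric] by simp
qed

text \<open>Up to scaling these are the probabilities of a binomial law with mean \<open>k\<close>: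
  the terms increase as long as \<open>i < k\<close> and decrease from \<open>i = k\<close>
  on.\<close>

lemma binomial_term_le_mode:
  assumes "k \<le> n" "j \<le> n"
  shows "(n choose j) * k ^ j * (n - k) ^ (n - j) \<le> (n choose k) * k ^ k * (n - k) ^ (n - k)"
proof -
  define c where "c j = (n choose j) * k ^ j * (n - k) ^ (n - j)" for j
  have ab: "Suc i * (n choose Suc i) = (n - i) * (n choose i)" for i
    by (metis binomial_absorb_comp binomial_absorption)
  have up: "c i \<le> c (Suc i)" if "i < k" for i
  proof -
    \<comment> \<open>The ratio test in multiplied form:
      \<open>(i + 1) * (n - k) <= k * (n - i)\<close> for \<open>i < k\<close>.\<close>
    have "Suc i * ((n choose i) * (n - k)) = (Suc i * (n - k)) * (n choose i)" by (simp only: mult_ac)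
    also have "\<dots> \<le> (k * (n - i)) * (n choose i)" using that by (intro mult_mono) auto
    also have "\<dots> = k * (Suc i * (n choose Suc i))" by (simp only: ab mult.assoc)
    finally have "Suc i * ((n choose i) * (n - k)) \<le> Suc i * ((n choose Suc i) * k)" by (simp only: mult_ac)
    then have "(n choose i) * (n - k) \<le> (n choose Suc i) * k" by (simp only: Suc_mult_le_cancel1)
    then have "((n choose i) * (n - k)) * (k ^ i * (n - k) ^ (n - Suc i))
        \<le> ((n choose Suc i) * k) * (k ^ i * (n - k) ^ (n - Suc i))" by (rule mult_right_mono) simp
    moreover have "n - i = Suc (n - Suc i)" using that assms by simp
    ultimately show ?thesis by (simp add: c_def mult_ac)
  qed
  have down: "c (Suc i) \<le> c i" if "k \<le> i" "i < n" for i
  proof -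
    have "Suc i * ((n choose Suc i) * k) = (n - i) * (n choose i) * k" by (simp only: ab mult.assoc[symmetric])
    also have "\<dots> = (k * (n - i)) * (n choose i)" by simp
    also have "\<dots> \<le> (Suc i * (n - k)) * (n choose i)" using that by (intro mult_mono) auto
    finally have "Suc i * ((n choose Suc i) * k) \<le> Suc i * ((n choose i) * (n - k))" by (simp only: mult_ac)
    then have "(n choose Suc i) * k \<le> (n choose i) * (n - k)" by (simp only: Suc_mult_le_cancel1)
    then have "((n choose Suc i) * k) * (k ^ i * (n - k) ^ (n - Suc i))
        \<le> ((n choose i) * (n - k)) * (k ^ i * (n - k) ^ (n - Suc i))" by (rule mult_right_mono) simp
    moreover have "n - i = Suc (n - Suc i)" using that assms by simp
    ultimately show ?thesis by (simp add: c_def mult_ac)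
  qed
  have "c j \<le> c k"
  proof (cases "j \<le> k")
    case True
    then show ?thesis
      by (induction rule: inc_induct) (auto intro: order_trans[OF up])
  next
    case False
    have "k \<le> j" using False by simp
    then show ?thesis using \<open>j \<le> n\<close>
      by (induction rule: dec_induct) (auto intro: order_trans[OF down])
  qed
  then show ?thesis by (simp add: c_def)
qed

text \<open>Of the \<open>n + 1\<close> terms of \<open>(k + (n - k)) ^ n\<close> the one at
  \<open>j = k\<close> is largest, so it lies between \<open>n ^ n / (n + 1)\<close> and
  \<open>n ^ n\<close>.\<close>

lemma binomial_entropy_bounds:
  assumes "k \<le> n" "n \<ge> 1"
  shows "real (n choose k) \<le> exp (real n * entropy (real k / real n))"
    and "exp (real n * entropy (real k / real n)) \<le> (real n + 1) * real (n choose k)"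
proof -
  define c where "c j = (n choose j) * k ^ j * (n - k) ^ (n - j)" for j
  define p where "p = k ^ k * (n - k) ^ (n - k)"
  have "p > 0" using assms by (auto simp: p_def)
  have "n ^ n = (\<Sum>j\<le>n. c j)"
    using binomial_ring[of k "n - k" n] assms by (simp add: c_def)
  moreover have "c k \<le> (\<Sum>j\<le>n. c j)" using assms by (intro member_le_sum) auto
  moreover have "(\<Sum>j\<le>n. c j) \<le> (\<Sum>j\<le>n. c k)"
    unfolding c_def using assms by (intro sum_mono binomial_term_le_mode) auto
  ultimately have "(n choose k) * p \<le> n ^ n" "n ^ n \<le> (n + 1) * ((n choose k) * p)"
    by (simp_all add: c_def p_def mult_ac)
  then have "real (n choose k) * real p \<le> real (n ^ n)"
    "real (n ^ n) \<le> (real n + 1) * (real (n choose k) * real p)"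
    by (metis of_nat_le_iff of_nat_mult, metis of_nat_le_iff of_nat_mult of_nat_add of_nat_1)
  moreover have "real (n ^ n) = exp (real n * entropy (real k / real n)) * real p"
    using exp_entropy_eq[OF assms] by (simp add: p_def mult_ac)
  ultimately show "real (n choose k) \<le> exp (real n * entropy (real k / real n))"
    "exp (real n * entropy (real k / real n)) \<le> (real n + 1) * real (n choose k)"
    using \<open>p > 0\<close> by (simp_all only: mult.assoc[symmetric] of_nat_0_less_iff mult_le_cancel_right_pos)
qed

section \<open>Sub-Gaussian estimates for signs\<close>

lemma cosh_le_exp: "exp t + exp (- t) \<le> 2 * exp (t\<^sup>2 / 2)" for t :: real
proof -
  have pos: "exp t + exp (- t) \<le> 2 * exp (t\<^sup>2 / 2)" if "t \<ge> 0" for t :: real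
  proof -
    \<comment> \<open>Hoeffding's lemma for a fair sign: the two values are \<open>2 * t\<close>
      apart, and \<open>(2 * t)^2 / 8 = t^2 / 2\<close>.\<close>
    have "- t + ln (1 + (exp (2 * t) - 1) / 2) \<le> t\<^sup>2 / 2"
      using Hoeffdings_lemma_aux[of "2 * t" "1 / 2"] that by (simp add: power2_eq_square)
    then have "exp (ln (1 + (exp (2 * t) - 1) / 2)) \<le> exp (t + t\<^sup>2 / 2)"
      by (simp only: exp_le_cancel_iff)
    moreover have "1 + (exp (2 * t) - 1) / 2 > (0::real)"
    proof -
      have "exp (2 * t) > (0::real)" by simp
      then show ?thesis by (simp add: field_simps add_pos_pos)
    qed
    ultimately have "1 + (exp (2 * t) - 1) / 2 \<le> exp t * exp (t\<^sup>2 / 2)"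
      by (simp add: exp_add)
    then have "1 + exp (2 * t) \<le> 2 * (exp t * exp (t\<^sup>2 / 2))"
      by (simp only: field_simps)
    then have "(1 + exp (2 * t)) * exp (- t) \<le> (2 * (exp t * exp (t\<^sup>2 / 2))) * exp (- t)"
      by (intro mult_right_mono) auto
    moreover have "(1 + exp (2 * t)) * exp (- t) = exp t + exp (- t)"
      by (simp add: distrib_right exp_add[symmetric])
    moreover have "(2 * (exp t * exp (t\<^sup>2 / 2))) * exp (- t) = 2 * exp (t\<^sup>2 / 2)"
      by (simp add: exp_minus)
    ultimately show ?thesis by simp
  qed
  show ?thesis using pos[of t] pos[of "- t"] by (cases "t \<ge> 0") (auto simp: add.commute)
qed

text \<open>Gibbs' inequality against the tilted law with weights proportional to \<open>exp (\<plusminus>x)\<close>,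
  \<open>x = 1 - 2g\<close>.\<close>

lemma entropy_le:
  assumes "0 \<le> g" "g \<le> 1"
  shows "entropy g \<le> ln 2 - (1 - 2 * g)\<^sup>2 / 2"
proof -
  define x where "x = 1 - 2 * g"
  define Z where "Z = exp x + exp (- x)"
  have Z: "Z > 0" by (simp add: Z_def add_pos_pos)
  have gibbs: "- (p * ln p) \<le> q - p - p * ln q" if "p \<ge> 0" "q > 0" for p q :: real
  proof (cases "p = 0")
    case False
    then have "ln (q / p) \<le> q / p - 1" using that by (intro ln_le_minus_one) auto
    then have "p * ln (q / p) \<le> p * (q / p - 1)" using that by (intro mult_left_mono) auto
    then show ?thesis using False that by (simp add: ln_div algebra_simps)
  qed (use that in auto)
  \<comment> \<open>The tilted weights \<open>exp (- x) / Z\<close> and \<open>exp x / Z\<close> sum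
    to 1, so the linear terms cancel. Since \<open>g - (1 - g) = - x\<close>, the logarithms leave
    \<open>ln Z - x * x\<close>.\<close>
  have "entropy g \<le> (exp (- x) / Z - g - g * ln (exp (- x) / Z))
      + (exp x / Z - (1 - g) - (1 - g) * ln (exp x / Z))"
    unfolding entropy_def using gibbs[of g "exp (- x) / Z"] gibbs[of "1 - g" "exp x / Z"] assms Z by simp
  also have "\<dots> = (exp x + exp (- x)) / Z - 1 + ln Z - x * x"
    using Z by (simp add: ln_div x_def add_divide_distrib algebra_simps)
  also have "\<dots> = ln Z - x * x" using Z by (simp add: Z_def)
  also have "ln Z \<le> ln (2 * exp (x\<^sup>2 / 2))"
    using cosh_le_exp[of x] Z by (simp add: Z_def)
  also have "\<dots> = ln 2 + x\<^sup>2 / 2" by (simp add: ln_mult)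
  finally show ?thesis by (simp add: x_def[symmetric] power2_eq_square)
qed

lemma entropy_le_ln2: "0 \<le> g \<Longrightarrow> g \<le> 1 \<Longrightarrow> entropy g \<le> ln 2"
  using entropy_le[of g] zero_le_power2[of "1 - 2 * g"] by linarith

lemma isCont_entropy: "0 < g \<Longrightarrow> g < 1 \<Longrightarrow> isCont entropy g"
  unfolding entropy_def by (intro continuous_intros) auto

section \<open>Sums over subsets\<close>

lemma sum_Pow_card:
  fixes f :: "nat \<Rightarrow> real"
  shows "(\<Sum>S\<in>Pow {..<n}. f (card S)) = (\<Sum>k\<le>n. real (n choose k) * f k)"
proof -
  have "(\<Sum>S\<in>Pow {..<n}. f (card S)) = (\<Sum>k\<le>n. \<Sum>S\<in>{S \<in> Pow {..<n}. card S = k}. f (card S))"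
    by (rule sum.group[symmetric]) (auto simp: card_subset_le)
  also have "\<dots> = (\<Sum>k\<le>n. real (n choose k) * f k)"
  proof (rule sum.cong[OF refl])
    fix k
    have "(\<Sum>S\<in>{S \<in> Pow {..<n}. card S = k}. f (card S)) = (\<Sum>S\<in>{S \<in> Pow {..<n}. card S = k}. f k)"
      by (rule sum.cong) auto
    also have "\<dots> = real (n choose k) * f k" using n_subsets[of "{..<n}" k] by simp
    finally show "(\<Sum>S\<in>{S \<in> Pow {..<n}. card S = k}. f (card S)) = real (n choose k) * f k" .
  qed
  finally show ?thesis .
qed

text \<open>Laplace's upper bound: there are \<open>n + 1\<close> levels, and the number of sets on
  level \<open>k\<close> is at most \<open>exp (n * entropy (k / n))\<close>.\<close>

lemma sum_Pow_le_entropy: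
  assumes "n \<ge> 1" "B \<ge> 0"
    and g: "\<And>S. S \<subseteq> {..<n} \<Longrightarrow> exp (real n * (entropy (card S / n) - ln 2)) * g S \<le> B"
  shows "(\<Sum>S\<in>Pow {..<n}. g S) / 2 ^ n \<le> (real n + 1) * B"
proof -
  \<comment> \<open>The largest value that the hypothesis permits for \<open>g\<close> on sets of
    size \<open>k\<close>.\<close>
  define f where "f k = B * 2 ^ n * exp (- (real n * entropy (real k / real n)))" for k :: nat
  have e2: "exp (real n * ln 2) = (2::real) ^ n" by (simp add: exp_of_nat_mult)
  have "(\<Sum>S\<in>Pow {..<n}. g S) \<le> (\<Sum>S\<in>Pow {..<n}. f (card S))"
  proof (rule sum_mono)
    fix S assume "S \<in> Pow {..<n}"
    then have "exp (real n * (entropy (card S / n) - ln 2)) * g S \<le> B" using g by auto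
    then have "(exp (real n * entropy (card S / n)) * g S) / 2 ^ n \<le> B"
      by (simp add: right_diff_distrib exp_diff e2)
    then have "exp (real n * entropy (card S / n)) * g S \<le> B * 2 ^ n"
      by (simp add: divide_le_eq)
    then show "g S \<le> f (card S)" by (simp add: f_def exp_minus field_simps)
  qed
  also have "\<dots> = (\<Sum>k\<le>n. real (n choose k) * f k)" by (rule sum_Pow_card)
  also have "\<dots> \<le> (\<Sum>k\<le>n. B * 2 ^ n)"
  proof (rule sum_mono)
    fix k assume k: "k \<in> {..n}"
    have "real (n choose k) * f k \<le> exp (real n * entropy (real k / real n)) * f k"
      using k assms binomial_entropy_bounds(1)[of k n] by (intro mult_right_mono) (auto simp: f_def)
    also have "\<dots> = B * 2 ^ n" by (simp add: f_def exp_minus)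
    finally show "real (n choose k) * f k \<le> B * 2 ^ n" .
  qed
  also have "\<dots> = (real n + 1) * B * 2 ^ n" by simp
  finally show ?thesis by (simp add: divide_le_eq)
qed

text \<open>\<open>n * bias n S\<close> is a sum of \<open>n\<close> independent fair signs under
  uniform \<open>S\<close>, so the moment generating function factors.\<close>

lemma exp_moment_bias:
  "(\<Sum>S\<in>Pow {..<n}. exp (t * (real n * bias n S))) \<le> 2 ^ n * exp (real n * t\<^sup>2 / 2)"
proof -
  have "(\<Sum>S\<in>Pow {..<n}. exp (t * (real n * bias n S)))
      = (\<Sum>S\<in>Pow {..<n}. \<Prod>i<n. exp (t * sign_of S i))"
    by (intro sum.cong refl) (simp add: sum_sign_of_bias[symmetric] sum_distrib_left exp_sum)
  also have "\<dots> = (exp (- t) + exp t) ^ n"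
    by (subst sum_Pow_prod_sign[where g = "\<lambda>e _. exp (t * e)"]) auto
  also have "\<dots> \<le> (2 * exp (t\<^sup>2 / 2)) ^ n"
    using cosh_le_exp[of t] by (intro power_mono) (auto simp: add.commute)
  also have "\<dots> = 2 ^ n * exp (real n * t\<^sup>2 / 2)"
    by (simp add: power_mult_distrib exp_of_nat_mult[symmetric])
  finally show ?thesis .
qed

text \<open>Linearise the square: \<open>y\<^sup>2/4 \<le> 1 + j y - j\<^sup>2\<close> for \<open>j = \<lfloor>y/2\<rfloor>\<close>.\<close>

lemma gaussian_moment_bias:
  assumes "n \<ge> 1"
  shows "(\<Sum>S\<in>Pow {..<n}. exp (real n * (bias n S)\<^sup>2 / 4)) / 2 ^ n
    \<le> 2 * exp 1 / (1 - exp (- 1 / 2))"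
proof -
  define y where "y S = sqrt n * bias n S" for S
  have n: "sqrt n > 0" "sqrt n * sqrt n = real n" using assms by auto
  have pt: "exp (real n * (bias n S)\<^sup>2 / 4) \<le> exp 1 * (\<Sum>j\<le>n. exp (- (real j)\<^sup>2) *
      (exp (real j * y S) + exp (- real j * y S)))" if S: "S \<subseteq> {..<n}" for S
  proof -
    define z where "z = \<bar>y S\<bar>"
    define j where "j = nat \<lfloor>z / 2\<rfloor>"
    have z: "z \<ge> 0" "z \<le> sqrt n"
      using abs_bias_le_1[OF S] n by (auto simp: z_def y_def abs_mult mult_left_le)
    have j: "real j \<le> z / 2" "z / 2 < real j + 1"
      using z unfolding j_def by linarith+
    \<comment> \<open>Keeps the chosen \<open>j\<close> inside the finite range
      \<open>j \<le> n\<close>, whatever \<open>S\<close> is.\<close>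
    have "sqrt n \<le> real n" using assms by (simp add: real_le_lsqrt self_le_power)
    then have jn: "j \<le> n" using j z by linarith
    have "(z / 2 - real j)\<^sup>2 \<le> 1" using j by (simp add: power2_le_iff_abs_le abs_le_iff abs_square_le_1)
    moreover have "(z / 2 - real j)\<^sup>2 = z\<^sup>2 / 4 - real j * z + (real j)\<^sup>2"
      by (simp add: power2_diff power_divide)
    ultimately have "z\<^sup>2 / 4 \<le> 1 + real j * z - (real j)\<^sup>2" by linarith
    moreover have "z\<^sup>2 = real n * (bias n S)\<^sup>2"
      by (simp add: z_def y_def power_mult_distrib)
    ultimately have "exp (real n * (bias n S)\<^sup>2 / 4) \<le> exp (1 + real j * z - (real j)\<^sup>2)" by simp
    also have "\<dots> = exp 1 * (exp (- (real j)\<^sup>2) * exp (real j * z))"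
      by (simp add: exp_add[symmetric])
    also have "exp (real j * z) \<le> exp (real j * y S) + exp (- real j * y S)"
      by (cases "y S \<ge> 0") (simp_all add: z_def)
    also have "exp (- (real j)\<^sup>2) * (exp (real j * y S) + exp (- real j * y S))
      \<le> (\<Sum>j\<le>n. exp (- (real j)\<^sup>2) * (exp (real j * y S) + exp (- real j * y S)))"
      using jn by (intro member_le_sum) (auto intro!: mult_nonneg_nonneg add_nonneg_nonneg)
    finally show ?thesis by simp
  qed
  \<comment> \<open>Taking \<open>t = c / sqrt n\<close> in \<open>exp_moment_bias\<close> leaves
    \<open>2 ^ n\<close> as the only dependence on \<open>n\<close>.\<close>
  have mom: "(\<Sum>S\<in>Pow {..<n}. exp (c * y S)) \<le> 2 ^ n * exp (c\<^sup>2 / 2)" for c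
  proof -
    have "c / q * (q * q * b) = c * (q * b)" if "q > 0" for q b :: real
      using that by simp
    from this[OF n(1)] have "c / sqrt n * (real n * b) = c * (sqrt n * b)" for b
      unfolding n(2) .
    then show ?thesis
      using exp_moment_bias[where t = "c / sqrt n" and n = n] assms
      by (simp add: y_def power_divide)
  qed
  have "(\<Sum>S\<in>Pow {..<n}. exp (real n * (bias n S)\<^sup>2 / 4))
     \<le> (\<Sum>S\<in>Pow {..<n}. exp 1 * (\<Sum>j\<le>n. exp (- (real j)\<^sup>2) *
      (exp (real j * y S) + exp (- real j * y S))))"
    by (intro sum_mono pt) auto
  also have "\<dots> = exp 1 * (\<Sum>j\<le>n. exp (- (real j)\<^sup>2) *
      ((\<Sum>S\<in>Pow {..<n}. exp (real j * y S)) + (\<Sum>S\<in>Pow {..<n}. exp (- real j * y S))))"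
    unfolding sum_distrib_left[symmetric] sum.distrib[symmetric]
    by (subst sum.swap) (simp add: sum_distrib_left)
  also have "\<dots> \<le> exp 1 * (\<Sum>j\<le>n. exp (- (real j)\<^sup>2) *
      (2 ^ n * exp ((real j)\<^sup>2 / 2) + 2 ^ n * exp ((real j)\<^sup>2 / 2)))"
    using mom[of "- real j" for j]
    by (intro mult_left_mono sum_mono add_mono mom) auto
  also have "\<dots> = 2 ^ n * (2 * exp 1) * (\<Sum>j\<le>n. exp (- (real j)\<^sup>2) * exp ((real j)\<^sup>2 / 2))"
    by (simp add: sum_distrib_left mult_ac)
  \<comment> \<open>The moments lose only half of the exponent \<open>j^2\<close>; since
    \<open>j <= j^2\<close>, the rest is dominated by a geometric series, uniformly in
    \<open>n\<close>.\<close>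
  also have "(\<Sum>j\<le>n. exp (- (real j)\<^sup>2) * exp ((real j)\<^sup>2 / 2)) \<le> (\<Sum>j\<le>n. exp (- 1 / 2) ^ j)"
  proof (rule sum_mono)
    fix j :: nat
    have "real j \<le> (real j)\<^sup>2"
      by (cases "j = 0") (auto simp: power2_eq_square)
    then show "exp (- (real j)\<^sup>2) * exp ((real j)\<^sup>2 / 2) \<le> exp (- 1 / 2) ^ j"
      by (simp add: exp_of_nat_mult[symmetric] exp_add[symmetric])
  qed
  also have "(\<Sum>j\<le>n. exp (- 1 / 2) ^ j) \<le> 1 / (1 - exp (- 1 / 2 :: real))"
  proof -
    have lt: "exp (- 1 / 2 :: real) < 1" by simp
    then have "(\<Sum>j\<le>n. exp (- 1 / 2) ^ j) \<le> (\<Sum>j. exp (- 1 / 2 :: real) ^ j)"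
      by (intro sum_le_suminf summable_geometric) auto
    then show ?thesis using lt by (simp add: suminf_geometric)
  qed
  finally show ?thesis by (simp add: divide_le_eq mult_ac)
qed

section \<open>The rate function\<close>

text \<open>The logarithm of the quotient under the supremum in \<open>F_rho\<close>, as
  \<open>F_rho_eq\<close> shows.\<close>

definition Phi :: "(real \<Rightarrow> real) \<Rightarrow> real \<Rightarrow> real \<Rightarrow> real" where
  "Phi \<rho> \<alpha> g = \<alpha> * ln (1 + \<rho> (1 - 2 * g)) + entropy g - ln 2"

context
  fixes \<rho> :: "real \<Rightarrow> real"
  assumes \<rho>: "\<And>s. 0 \<le> s \<Longrightarrow> s \<le> 1 \<Longrightarrow> 0 \<le> \<rho> s \<and> \<rho> s \<le> 1"
begin

lemma ln_rho_bounds: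
  assumes "g \<in> {0..1/2}"
  shows "0 \<le> ln (1 + \<rho> (1 - 2 * g))" "ln (1 + \<rho> (1 - 2 * g)) \<le> ln 2"
  using \<rho>[of "1 - 2 * g"] assms by auto

lemma F_rho_eq: "F_rho \<rho> \<alpha> = ln (SUP g\<in>{0..1/2}. exp (Phi \<rho> \<alpha> g))"
proof -
  have "pow0 (1 + \<rho> (1 - 2 * g)) \<alpha> / (2 * pow0 g g * pow0 (1 - g) (1 - g)) = exp (Phi \<rho> \<alpha> g)"
    if g: "g \<in> {0..1/2}" for g
  proof -
    have "pow0 (1 + \<rho> (1 - 2 * g)) \<alpha> = exp (\<alpha> * ln (1 + \<rho> (1 - 2 * g)))"
      using \<rho>[of "1 - 2 * g"] g by (auto simp: pow0_def powr_def)
    then have "pow0 (1 + \<rho> (1 - 2 * g)) \<alpha> * (1 / (2 * pow0 g g * pow0 (1 - g) (1 - g)))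
        = exp (\<alpha> * ln (1 + \<rho> (1 - 2 * g))) * exp (entropy g - ln 2)"
      using g by (subst pow0_entropy) auto
    then show ?thesis by (simp add: Phi_def exp_add[symmetric] add_diff_eq)
  qed
  then show ?thesis unfolding F_rho_def by (intro arg_cong[where f = ln] SUP_cong) auto
qed

lemma Phi_bound:
  assumes "\<alpha> \<ge> 0" "g \<in> {0..1/2}"
  shows "Phi \<rho> \<alpha> g \<le> \<alpha> * ln 2"
  using mult_left_mono[OF ln_rho_bounds(2)[OF assms(2)] assms(1)] entropy_le_ln2[of g] assms
  by (auto simp: Phi_def)

lemma bdd_above_exp_Phi: "\<alpha> \<ge> 0 \<Longrightarrow> bdd_above ((\<lambda>g. exp (Phi \<rho> \<alpha> g)) ` {0..1/2})"
  by (rule bdd_aboveI2[where M = "exp (\<alpha> * ln 2)"]) (use Phi_bound in auto)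

lemma SUP_exp_Phi_pos: "\<alpha> \<ge> 0 \<Longrightarrow> (SUP g\<in>{0..1/2}. exp (Phi \<rho> \<alpha> g)) > 0"
proof -
  assume "\<alpha> \<ge> 0"
  then have "exp (Phi \<rho> \<alpha> 0) \<le> (SUP g\<in>{0..1/2}. exp (Phi \<rho> \<alpha> g))"
    by (intro cSUP_upper bdd_above_exp_Phi) auto
  then show ?thesis by (rule less_le_trans[rotated]) simp
qed

text \<open>With \<open>F_rho_le\<close> this identifies \<open>F_rho\<close> as the supremum of
  \<open>Phi\<close>; boundedness and positivity of the inner supremum allow \<open>ln\<close> to be
  applied monotonically.\<close>

lemma Phi_le_F_rho:
  assumes "\<alpha> \<ge> 0" "g \<in> {0..1/2}"
  shows "Phi \<rho> \<alpha> g \<le> F_rho \<rho> \<alpha>"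
proof -
  have "exp (Phi \<rho> \<alpha> g) \<le> (SUP g\<in>{0..1/2}. exp (Phi \<rho> \<alpha> g))"
    using assms by (intro cSUP_upper bdd_above_exp_Phi) auto
  then have "ln (exp (Phi \<rho> \<alpha> g)) \<le> ln (SUP g\<in>{0..1/2}. exp (Phi \<rho> \<alpha> g))"
    using SUP_exp_Phi_pos[OF assms(1)] by (subst ln_le_cancel_iff) auto
  then show ?thesis by (simp add: F_rho_eq)
qed

lemma F_rho_le:
  assumes "\<alpha> \<ge> 0" "\<And>g. g \<in> {0..1/2} \<Longrightarrow> Phi \<rho> \<alpha> g \<le> c"
  shows "F_rho \<rho> \<alpha> \<le> c"
proof -
  have "(SUP g\<in>{0..1/2}. exp (Phi \<rho> \<alpha> g)) \<le> exp c"
    using assms by (intro cSUP_least) auto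
  then have "ln (SUP g\<in>{0..1/2}. exp (Phi \<rho> \<alpha> g)) \<le> ln (exp c)"
    using SUP_exp_Phi_pos[OF assms(1)] by (subst ln_le_cancel_iff) auto
  then show ?thesis by (simp add: F_rho_eq)
qed

text \<open>At \<open>g = 1/2\<close> the entropy is \<open>ln 2\<close> and
  \<open>\<rho> 0 = 0\<close>, so \<open>Phi\<close> vanishes there.\<close>

lemma F_rho_nonneg:
  assumes "\<rho> 0 = 0" "\<alpha> \<ge> 0"
  shows "F_rho \<rho> \<alpha> \<ge> 0"
proof -
  have "entropy (1 / 2) = ln 2" by (simp add: entropy_def ln_div)
  then have "Phi \<rho> \<alpha> (1 / 2) = 0" by (simp add: Phi_def assms)
  then show ?thesis using Phi_le_F_rho[OF assms(2), of "1 / 2"] by auto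
qed

text \<open>For fixed \<open>g\<close>, \<open>Phi\<close> is affine in its parameter with slope
  between 0 and \<open>ln 2\<close>; both bounds survive the supremum.\<close>

lemma F_rho_mono_Lipschitz:
  assumes "0 \<le> \<alpha>" "\<alpha> \<le> \<beta>"
  shows "F_rho \<rho> \<alpha> \<le> F_rho \<rho> \<beta>" "F_rho \<rho> \<beta> \<le> F_rho \<rho> \<alpha> + (\<beta> - \<alpha>) * ln 2"
proof -
  have d: "Phi \<rho> \<beta> g = Phi \<rho> \<alpha> g + (\<beta> - \<alpha>) * ln (1 + \<rho> (1 - 2 * g))" for g
    by (simp add: Phi_def algebra_simps)
  have 1: "Phi \<rho> \<alpha> g \<le> Phi \<rho> \<beta> g" "Phi \<rho> \<beta> g \<le> Phi \<rho> \<alpha> g + (\<beta> - \<alpha>) * ln 2"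
    if g: "g \<in> {0..1/2}" for g
    unfolding d using assms ln_rho_bounds[OF g] by (simp_all add: mult_left_mono)
  show "F_rho \<rho> \<alpha> \<le> F_rho \<rho> \<beta>"
  proof (rule F_rho_le)
    fix g :: real assume g: "g \<in> {0..1/2}"
    show "Phi \<rho> \<alpha> g \<le> F_rho \<rho> \<beta>"
      using 1(1)[OF g] Phi_le_F_rho[OF _ g, of \<beta>] assms by linarith
  qed (use assms in auto)
  show "F_rho \<rho> \<beta> \<le> F_rho \<rho> \<alpha> + (\<beta> - \<alpha>) * ln 2"
    using assms
  proof (intro F_rho_le)
    fix g :: real assume g: "g \<in> {0..1/2}"
    show "Phi \<rho> \<beta> g \<le> F_rho \<rho> \<alpha> + (\<beta> - \<alpha>) * ln 2"
      using 1(2)[OF g] Phi_le_F_rho[OF assms(1) g] by linarith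
  qed auto
qed

lemma F_rho_pos:
  assumes "\<rho> 1 = 1" "\<alpha> > alpha_star \<rho>"
  shows "F_rho \<rho> \<alpha> > 0"
proof -
  \<comment> \<open>The point 2, tested at \<open>g = 0\<close>, shows that the infimum defining
    \<open>alpha_star\<close> is over a nonempty set.\<close>
  have "Phi \<rho> 2 0 = ln 2" by (simp add: Phi_def entropy_def assms)
  moreover have "Phi \<rho> 2 0 \<le> F_rho \<rho> 2" by (rule Phi_le_F_rho) auto
  moreover have "ln 2 > (0::real)" by simp
  ultimately have "F_rho \<rho> 2 > 0" by linarith
  then have "{\<alpha>. \<alpha> \<ge> 0 \<and> F_rho \<rho> \<alpha> > 0} \<noteq> {}" by (auto intro!: exI[of _ 2])
  from cInf_lessD[OF this assms(2)[unfolded alpha_star_def]]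
  obtain \<beta> where "\<beta> \<ge> 0" "F_rho \<rho> \<beta> > 0" "\<beta> < \<alpha>" by blast
  then show ?thesis using F_rho_mono_Lipschitz(1)[of \<beta> \<alpha>] by simp
qed

text \<open>Strictly below \<open>alpha_star\<close> the value cannot be positive, by definition of
  the infimum; the Lipschitz bound extends this to the endpoint.\<close>

lemma F_rho_eq_0:
  assumes "\<rho> 0 = 0" "\<alpha> > 0" "\<alpha> \<le> alpha_star \<rho>"
  shows "F_rho \<rho> \<alpha> = 0"
proof -
  have below: "F_rho \<rho> \<beta> \<le> 0" if "0 \<le> \<beta>" "\<beta> < \<alpha>" for \<beta>
  proof (rule ccontr)
    assume "\<not> F_rho \<rho> \<beta> \<le> 0"
    then have "alpha_star \<rho> \<le> \<beta>"
      unfolding alpha_star_def using that by (intro cInf_lower bdd_belowI[where m = 0]) auto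
    then show False using that assms by simp
  qed
  have "F_rho \<rho> \<alpha> \<le> 0 + e" if "e > 0" for e
  proof -
    define b where "b = max 0 (\<alpha> - e)"
    have b: "0 \<le> b" "b < \<alpha>" "\<alpha> - b \<le> e" using assms that by (auto simp: b_def)
    have "F_rho \<rho> \<alpha> \<le> F_rho \<rho> b + (\<alpha> - b) * ln 2" using b by (intro F_rho_mono_Lipschitz) auto
    also have "\<dots> \<le> 0 + (\<alpha> - b) * 1"
      using below[OF b(1,2)] b ln_2_less_1 by (intro add_mono mult_left_mono) auto
    finally show ?thesis using b by simp
  qed
  then have "F_rho \<rho> \<alpha> \<le> 0" by (rule field_le_epsilon)
  then show ?thesis using F_rho_nonneg[of \<alpha>] assms by simp
qed

end

section \<open>Asymptotics of the expectation\<close>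

text \<open>With \<open>r\<close> the generating function at the modulus of the bias,
  \<open>1 + l <= (1 + r) * exp e\<close>. Entropy is symmetric, so the whole term depends on that
  modulus only; \<open>m\<close> may be raised to \<open>\<beta> * n\<close> because
  \<open>ln (1 + r) + e\<close> is nonnegative.\<close>

lemma entropy_term_bound:
  assumes "n \<ge> 1" "S \<subseteq> {..<n}" "0 \<le> 1 + l" "l \<le> gen_fun W (bias n S) + e" "e \<ge> 0"
    "real m \<le> \<beta> * real n"
  shows "exp (real n * (entropy (card S / n) - ln 2)) * (1 + l) ^ m
    \<le> exp (real n * (Phi (gen_fun W) \<beta> ((1 - \<bar>bias n S\<bar>) / 2) + \<beta> * e))"
proof -
  define b where "b = bias n S"
  define r where "r = gen_fun W \<bar>b\<bar>"
  have b1: "\<bar>b\<bar> \<le> 1" using abs_bias_le_1[OF assms(2)] by (simp add: b_def)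
  note r = abs_gen_fun_le[OF b1, of W, folded r_def]
  have "1 + l \<le> 1 + r + e" using r(1) assms(4) by (simp add: b_def)
  also have "\<dots> \<le> (1 + r) * (1 + e)" using r assms by (simp add: algebra_simps)
  also have "\<dots> \<le> exp (ln (1 + r)) * exp e"
    using r exp_ge_add_one_self[of e] assms(5) by (intro mult_mono) auto
  also have "\<dots> = exp (ln (1 + r) + e)" by (simp add: exp_add)
  finally have "(1 + l) ^ m \<le> exp (ln (1 + r) + e) ^ m" using assms by (intro power_mono) auto
  also have "\<dots> = exp (real m * (ln (1 + r) + e))" by (simp add: exp_of_nat_mult)
  also have "\<dots> \<le> exp (\<beta> * real n * (ln (1 + r) + e))"
    using assms r by (simp add: mult_right_mono)
  finally have 1: "(1 + l) ^ m \<le> exp (\<beta> * real n * (ln (1 + r) + e))" .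
  have c: "card S / n = (1 - b) / 2" by (simp add: b_def bias_def)
  have e1: "entropy (card S / n) = entropy ((1 - \<bar>b\<bar>) / 2)"
  proof (cases "b \<ge> 0")
    case False
    then have "(1 - \<bar>b\<bar>) / 2 = 1 - card S / n" unfolding c by (simp add: field_simps)
    then show ?thesis by (simp only: entropy_sym)
  qed (simp add: c)
  have e2: "1 - 2 * ((1 - \<bar>b\<bar>) / 2) = \<bar>b\<bar>" by (simp add: diff_divide_distrib)
  have "real n * (entropy (card S / n) - ln 2) + \<beta> * real n * (ln (1 + r) + e)
      = real n * (Phi (gen_fun W) \<beta> ((1 - \<bar>b\<bar>) / 2) + \<beta> * e)"
    unfolding Phi_def r_def e1 e2 by (simp add: algebra_simps)
  moreover have "exp (real n * (entropy (card S / n) - ln 2)) * (1 + l) ^ m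
      \<le> exp (real n * (entropy (card S / n) - ln 2)) * exp (\<beta> * real n * (ln (1 + r) + e))"
    using 1 by (intro mult_left_mono) auto
  ultimately show ?thesis by (simp only: b_def[symmetric] exp_add[symmetric])
qed

section \<open>Second-order expansion\<close>

lemma expected_null_count_minus_1:
  assumes "set_pmf w \<subseteq> {1..n}"
  shows "expected_null_count w n m - 1
    = (\<Sum>S\<in>Pow {..<n}. (1 + mean_char w n S) ^ m - 1 - real m * mean_char w n S) / 2 ^ n"
  using sum_mean_char[OF assms]
  by (simp add: expected_null_count_eq[OF assms] sum_subtractf sum_distrib_left[symmetric]
      card_Pow diff_divide_distrib)

text \<open>After removal of the first-order term every summand is nonnegative by Bernoulli's
  inequality.\<close>

lemma expected_null_count_ge_1:
  assumes "set_pmf w \<subseteq> {1..n}"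
  shows "expected_null_count w n m \<ge> 1"
proof -
  have "(1 + mean_char w n S) ^ m - 1 - real m * mean_char w n S \<ge> 0" for S
  proof -
    have "mean_char w n S \<ge> - 1" using abs_mean_char_le_1[of w n S] by linarith
    from Bernoulli_inequality[OF this, of m] show ?thesis by linarith
  qed
  then have "expected_null_count w n m - 1 \<ge> 0"
    unfolding expected_null_count_minus_1[OF assms] by (intro divide_nonneg_nonneg sum_nonneg) auto
  then show ?thesis by simp
qed

lemma exp_le_second_order: "exp z \<le> 1 + z + z\<^sup>2 * exp \<bar>z\<bar>" for z :: real
proof (cases "z \<ge> 0")
  case True
  have neg: "1 - exp (- z) \<le> z" using exp_ge_add_one_self[of "- z"] by linarith
  have "exp z * (1 - exp (- z)) \<le> exp z * z" using neg by (intro mult_left_mono) auto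
  then have "exp z - 1 \<le> z * exp z" by (simp add: right_diff_distrib exp_minus mult.commute)
  moreover from this have "z * (exp z - 1) \<le> z * (z * exp z)" using True by (intro mult_left_mono)
  ultimately show ?thesis using True by (simp add: power2_eq_square algebra_simps)
next
  case False
  have "exp z * (1 - exp (- z)) \<le> exp z * z"
    using exp_ge_add_one_self[of "- z"] by (intro mult_left_mono) auto
  then have 1: "exp z - 1 \<le> z * exp z" by (simp add: right_diff_distrib exp_minus mult.commute)
  have "(- z) * (1 - exp z) \<le> (- z) * (- z)"
    using False exp_ge_add_one_self[of z] by (intro mult_left_mono) linarith+
  then have "z * exp z - z \<le> z\<^sup>2" by (simp add: power2_eq_square algebra_simps)
  moreover have "z\<^sup>2 * 1 \<le> z\<^sup>2 * exp \<bar>z\<bar>" by (intro mult_left_mono) auto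
  ultimately show ?thesis using 1 by linarith
qed

lemma power_le_fact_exp: "x ^ r \<le> fact r * exp x" if "x \<ge> 0" for x :: real
proof -
  have "(\<Sum>k\<in>{r}. x ^ k /\<^sub>R fact k) \<le> (\<Sum>k. x ^ k /\<^sub>R fact k)"
    using that by (intro sum_le_suminf summable_exp_generic) auto
  then have "x ^ r / fact r \<le> exp x" by (simp add: exp_def divide_inverse mult.commute)
  then show ?thesis by (simp add: divide_le_eq mult.commute)
qed

text \<open>With \<open>z = m * l\<close> and \<open>v = n * b^2 + 1\<close>, the aim is
  \<open>\<bar>z\<bar> \<le> v / 8\<close> together with a bound on \<open>z^2\<close> costing
  another \<open>exp (v / 8)\<close>. Their product is \<open>exp (v / 4)\<close>, exactly the
  growth that \<open>gaussian_moment_bias\<close> can average.\<close>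

lemma central_term:
  assumes n: "n \<ge> 1" and r: "r \<ge> 3" and l: "-1 \<le> l" "\<bar>l\<bar> \<le> C0 * (\<bar>b\<bar> + 1 / sqrt n) ^ r"
    and C: "C0 \<ge> 0" "C1 \<ge> 0" and m: "real m \<le> C1 * real n"
    and u1: "\<bar>b\<bar> + 1 / sqrt n \<le> 1" and small: "16 * (C0 * C1) * (\<bar>b\<bar> + 1 / sqrt n) \<le> 1"
  shows "(1 + l) ^ m - 1 - real m * l
    \<le> (C1\<^sup>2 * C0\<^sup>2 * 16 ^ r * fact r * exp (1 / 4)) * (real n ^ 2 / real n ^ r) * exp (real n * b\<^sup>2 / 4)"
proof -
  define u where "u = \<bar>b\<bar> + 1 / sqrt n"
  define v where "v = real n * b\<^sup>2 + 1"
  define z where "z = real m * l"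
  have n0: "real n > 0" using n by simp
  have u0: "0 \<le> u" by (simp add: u_def)
  have v: "v \<ge> 1" by (simp add: v_def)
  have "(\<bar>b\<bar> - 1 / sqrt n)\<^sup>2 \<ge> 0" by simp
  then have "u\<^sup>2 \<le> 2 * b\<^sup>2 + 2 * (1 / sqrt n)\<^sup>2"
    by (simp add: u_def power2_sum power2_diff)
  also have "\<dots> = 2 * v / real n" using n0 by (simp add: v_def power_divide field_simps)
  finally have uv: "u\<^sup>2 \<le> 2 * v / real n" .
  have l': "\<bar>l\<bar> \<le> C0 * u ^ r" using l by (simp add: u_def)
  \<comment> \<open>Here \<open>r >= 3\<close> matters: two factors \<open>u\<close> cancel the
    \<open>n\<close> in \<open>m\<close>, and a third remains to be made small.\<close>
  have "u ^ r \<le> u ^ 3" using u0 u1 r by (intro power_decreasing) (auto simp: u_def)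
  also have "\<dots> = u\<^sup>2 * u" by (simp add: eval_nat_numeral)
  also have "\<dots> \<le> 2 * v / real n * u" using uv u0 by (rule mult_right_mono)
  finally have ur: "u ^ r \<le> 2 * v / real n * u" .
  have z0: "\<bar>z\<bar> \<le> (C1 * real n) * (C0 * u ^ r)"
    unfolding z_def abs_mult using m l' C n0 by (intro mult_mono) auto
  also have "\<dots> \<le> (C1 * real n) * (C0 * (2 * v / real n * u))"
    using ur C n0 by (intro mult_left_mono) auto
  also have "\<dots> = v / 8 * (16 * (C0 * C1) * u)" using n0 by simp
  also have "\<dots> \<le> v / 8 * 1" using small v unfolding u_def by (intro mult_left_mono) auto
  finally have z1: "\<bar>z\<bar> \<le> v / 8" by simp
  from z0 have "\<bar>z\<bar>\<^sup>2 \<le> ((C1 * real n) * (C0 * u ^ r))\<^sup>2" by (intro power_mono) auto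
  also have "\<dots> = C1\<^sup>2 * C0\<^sup>2 * real n ^ 2 * (u\<^sup>2) ^ r"
    by (simp add: power_mult_distrib power_mult[symmetric] mult.commute)
  also have "\<dots> \<le> C1\<^sup>2 * C0\<^sup>2 * real n ^ 2 * (2 * v / real n) ^ r"
    using uv by (intro mult_left_mono power_mono) auto
  \<comment> \<open>Rescaled to powers of \<open>v / 8\<close>, which
    \<open>power_le_fact_exp\<close> converts into \<open>exp (v / 8)\<close>.\<close>
  also have "(2 * v / real n) ^ r = (16 / real n * (v / 8)) ^ r" by simp
  also have "\<dots> = 16 ^ r / real n ^ r * (v / 8) ^ r"
    by (simp only: power_mult_distrib power_divide)
  also have "\<dots> \<le> 16 ^ r / real n ^ r * (fact r * exp (v / 8))"
    using v by (intro mult_left_mono power_le_fact_exp) auto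
  finally have z2: "z\<^sup>2 \<le> C1\<^sup>2 * C0\<^sup>2 * real n ^ 2 * (16 ^ r / real n ^ r * (fact r * exp (v / 8)))"
    by (simp add: mult_left_mono)
  have "(1 + l) ^ m \<le> exp l ^ m" using l exp_ge_add_one_self[of l] by (intro power_mono) auto
  also have "\<dots> = exp z" by (simp add: z_def exp_of_nat_mult)
  also have "\<dots> \<le> 1 + z + z\<^sup>2 * exp \<bar>z\<bar>" by (rule exp_le_second_order)
  finally have "(1 + l) ^ m - 1 - z \<le> z\<^sup>2 * exp \<bar>z\<bar>" by simp
  also have "\<dots> \<le> (C1\<^sup>2 * C0\<^sup>2 * real n ^ 2 * (16 ^ r / real n ^ r * (fact r * exp (v / 8)))) * exp (v / 8)"
    using z1 z2 by (intro mult_mono) auto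
  also have "\<dots> = (C1\<^sup>2 * C0\<^sup>2 * 16 ^ r * fact r) * (real n ^ 2 / real n ^ r) * (exp (v / 8) * exp (v / 8))"
    by simp
  also have "exp (v / 8) * exp (v / 8) = exp (1 / 4) * exp (real n * b\<^sup>2 / 4)"
    unfolding exp_add[symmetric] v_def by (simp add: add_divide_distrib)
  finally show ?thesis by (simp only: z_def mult_ac)
qed

context
  fixes W :: "nat pmf" and Wn :: "nat \<Rightarrow> nat pmf" and m :: "nat \<Rightarrow> nat" and \<alpha> :: real
  assumes W_pos: "set_pmf W \<subseteq> {1..}"
    and Wn_range: "\<And>n. n \<ge> 1 \<Longrightarrow> set_pmf (Wn n) \<subseteq> {1..n}"
    and Wn_conv: "converges_in_distribution Wn W"
    and alpha_pos: "\<alpha> > 0"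
    and m_lim: "(\<lambda>n. real (m n) / real n) \<longlonglongrightarrow> \<alpha>"
begin

section \<open>Exponential growth rate\<close>

lemma eventually_m_le:
  assumes "\<beta> > \<alpha>"
  shows "\<forall>\<^sub>F n in sequentially. real (m n) \<le> \<beta> * real n"
  using order_tendstoD(2)[OF m_lim assms] eventually_gt_at_top[of 0]
  by eventually_elim (simp add: divide_less_eq less_imp_le)

text \<open>Replacing \<open>m n\<close> by \<open>(\<alpha> + e) * n\<close> costs
  \<open>e * ln 2\<close> by the Lipschitz bound, and the uniform error of the mean characters costs
  \<open>(\<alpha> + e) * e\<close>.\<close>

lemma upper_bound:
  assumes "e > 0"
  shows "\<forall>\<^sub>F n in sequentially. ln (expected_null_count (Wn n) n (m n)) / real n
    \<le> ln (real n + 1) / real n + (F_rho (gen_fun W) \<alpha> + e * ln 2 + (\<alpha> + e) * e)"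
  using mean_char_uniform[OF Wn_conv \<open>e > 0\<close>]
    eventually_m_le[of "\<alpha> + e", simplified, OF \<open>e > 0\<close>] eventually_gt_at_top[of 0]
proof eventually_elim
  case (elim n)
  define G where "G = F_rho (gen_fun W) \<alpha> + e * ln 2 + (\<alpha> + e) * e"
  have n: "n \<ge> 1" using elim by simp
  have F: "F_rho (gen_fun W) (\<alpha> + e) \<le> F_rho (gen_fun W) \<alpha> + e * ln 2"
    using F_rho_mono_Lipschitz(2)[of "gen_fun W" \<alpha> "\<alpha> + e", OF gen_fun_bounds] alpha_pos assms by simp
  have "expected_null_count (Wn n) n (m n) \<le> (real n + 1) * exp (real n * G)"
    unfolding expected_null_count_eq[OF Wn_range[OF n]]
  proof (rule sum_Pow_le_entropy[OF n])
    fix S assume S: "S \<subseteq> {..<n}"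
    have "exp (real n * (entropy (card S / n) - ln 2)) * (1 + mean_char (Wn n) n S) ^ m n
      \<le> exp (real n * (Phi (gen_fun W) (\<alpha> + e) ((1 - \<bar>bias n S\<bar>) / 2) + (\<alpha> + e) * e))"
    proof (rule entropy_term_bound[OF n S])
      have "\<bar>mean_char (Wn n) n S - gen_fun W (bias n S)\<bar> < e" using elim(1) S by blast
      then show "mean_char (Wn n) n S \<le> gen_fun W (bias n S) + e" by linarith
      show "0 \<le> 1 + mean_char (Wn n) n S" using abs_mean_char_le_1[of "Wn n" n S] by linarith
    qed (use elim assms in auto)
    also have "\<dots> \<le> exp (real n * G)"
    proof -
      have "Phi (gen_fun W) (\<alpha> + e) ((1 - \<bar>bias n S\<bar>) / 2) \<le> F_rho (gen_fun W) (\<alpha> + e)"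
        using abs_bias_le_1[OF S] alpha_pos assms by (intro Phi_le_F_rho gen_fun_bounds) auto
      then show ?thesis using F by (simp add: G_def mult_left_mono)
    qed
    finally show "exp (real n * (entropy (card S / n) - ln 2)) * (1 + mean_char (Wn n) n S) ^ m n
      \<le> exp (real n * G)" .
  qed simp
  then have "ln (expected_null_count (Wn n) n (m n)) \<le> ln ((real n + 1) * exp (real n * G))"
    using expected_null_count_ge_1[OF Wn_range[OF n], of "m n"] by (subst ln_le_cancel_iff) auto
  also have "\<dots> = ln (real n + 1) + real n * G" by (simp add: ln_mult)
  finally have "ln (expected_null_count (Wn n) n (m n)) / real n \<le> (ln (real n + 1) + real n * G) / real n"
    by (intro divide_right_mono) auto
  then show ?case using n by (simp add: add_divide_distrib G_def)
qed

text \<open>All terms are nonnegative, so keeping only the sets of size \<open>k n\<close> gives a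
  lower bound. There \<open>1 + mean_char\<close> is at least
  \<open>1 + r - e >= (1 + r) * (1 - e)\<close>, which separates the error in the logarithm.\<close>

lemma lower_bound:
  assumes "0 < e" "e < 1" and g: "g \<in> {0..1/2}"
  defines "k \<equiv> \<lambda>n. nat \<lfloor>g * real n\<rfloor>"
  shows "\<forall>\<^sub>F n in sequentially. entropy (k n / n) - ln 2 - ln (real n + 1) / real n
      + real (m n) / real n * (ln (1 + gen_fun W (1 - 2 * (k n / n))) + ln (1 - e))
    \<le> ln (expected_null_count (Wn n) n (m n)) / real n"
  using mean_char_uniform[OF Wn_conv \<open>e > 0\<close>] eventually_gt_at_top[of 0]
proof eventually_elim
  case (elim n)
  have n: "n \<ge> 1" "real n > 0" using elim by auto
  have kn: "real (k n) \<le> g * real n" using g by (simp add: k_def)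
  then have "real (k n) \<le> 1 / 2 * real n" using g by (elim order_trans) (intro mult_right_mono, auto)
  then have k2: "k n \<le> n" "real (k n) / real n \<le> 1 / 2" using n by (auto simp: divide_le_eq)
  define r where "r = gen_fun W (1 - 2 * (k n / n))"
  have r: "0 \<le> r" "r \<le> 1" using gen_fun_bounds[of "1 - 2 * (k n / n)" W] k2 by (auto simp: r_def)
  define B where "B = exp (real (m n) * (ln (1 + r) + ln (1 - e)))"
  have B: "B = ((1 + r) * (1 - e)) ^ m n"
    using r assms by (simp add: B_def exp_of_nat_mult exp_add)
  have tm: "B \<le> (1 + mean_char (Wn n) n S) ^ m n" if S: "S \<subseteq> {..<n}" "card S = k n" for S
  proof -
    have "mean_char (Wn n) n S \<ge> r - e"
    proof -
      have "\<bar>mean_char (Wn n) n S - gen_fun W (bias n S)\<bar> < e" using elim(1) S by blast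
      moreover have "gen_fun W (bias n S) = r" by (simp only: r_def bias_def S)
      ultimately show ?thesis by linarith
    qed
    moreover have "(1 + r) * (1 - e) \<le> 1 + r - e" using r assms by (simp add: algebra_simps)
    ultimately show ?thesis unfolding B using r assms by (intro power_mono) auto
  qed
  have "real (n choose k n) * B = (\<Sum>S\<in>{S \<in> Pow {..<n}. card S = k n}. B)"
    using n_subsets[of "{..<n}" "k n"] by simp
  also have "\<dots> \<le> (\<Sum>S\<in>{S \<in> Pow {..<n}. card S = k n}. (1 + mean_char (Wn n) n S) ^ m n)"
    by (intro sum_mono tm) auto
  also have "\<dots> \<le> (\<Sum>S\<in>Pow {..<n}. (1 + mean_char (Wn n) n S) ^ m n)"
  proof (intro sum_mono2)
    fix S show "0 \<le> (1 + mean_char (Wn n) n S) ^ m n"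
      using abs_mean_char_le_1[of "Wn n" n S] by (intro zero_le_power) linarith
  qed auto
  also have "\<dots> = 2 ^ n * expected_null_count (Wn n) n (m n)"
    by (simp add: expected_null_count_eq[OF Wn_range[OF n(1)]])
  finally have 1: "real (n choose k n) * B \<le> 2 ^ n * expected_null_count (Wn n) n (m n)" .
  have "exp (real n * entropy (k n / n)) * B \<le> (real n + 1) * real (n choose k n) * B"
    using binomial_entropy_bounds(2)[OF k2(1) n(1)] by (intro mult_right_mono) (auto simp: B_def)
  also have "\<dots> \<le> (real n + 1) * (2 ^ n * expected_null_count (Wn n) n (m n))"
    using 1 by (simp only: mult.assoc) (intro mult_left_mono, auto)
  finally have "ln (exp (real n * entropy (k n / n)) * B)
      \<le> ln ((real n + 1) * (2 ^ n * expected_null_count (Wn n) n (m n)))"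
    using expected_null_count_ge_1[OF Wn_range[OF n(1)], of "m n"]
    by (subst ln_le_cancel_iff) (auto simp: B_def)
  then have "real n * entropy (k n / n) + real (m n) * (ln (1 + r) + ln (1 - e))
      \<le> ln (real n + 1) + real n * ln 2 + ln (expected_null_count (Wn n) n (m n))"
    using expected_null_count_ge_1[OF Wn_range[OF n(1)], of "m n"]
    by (simp add: B_def ln_mult ln_realpow)
  then have "(real n * entropy (k n / n) + real (m n) * (ln (1 + r) + ln (1 - e))
       - ln (real n + 1) - real n * ln 2) / real n
      \<le> ln (expected_null_count (Wn n) n (m n)) / real n"
    by (intro divide_right_mono) auto
  moreover have eq: "(N * X + M * Y - L - N * Z) / N = X - Z - L / N + M / N * Y" if "N > 0"
    for N X M Y L Z :: real
    using that by (simp add: field_simps)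
  ultimately show ?case
    unfolding eq[OF n(2)] r_def by (simp only:)
qed

lemma lower_bound_tendsto:
  assumes g: "g \<in> {0..1/2}"
  defines "k \<equiv> \<lambda>n. nat \<lfloor>g * real n\<rfloor>"
  shows "(\<lambda>n. entropy (k n / n) - ln 2 - ln (real n + 1) / real n
      + real (m n) / real n * (ln (1 + gen_fun W (1 - 2 * (k n / n))) + c))
    \<longlonglongrightarrow> Phi (gen_fun W) \<alpha> g + \<alpha> * c"
proof -
  have kg: "(\<lambda>n. real (k n) / real n) \<longlonglongrightarrow> g"
  proof (rule tendsto_sandwich)
    have low: "g * real n - 1 \<le> real (k n)" for n unfolding k_def by linarith
    show "\<forall>\<^sub>F n in sequentially. g - 1 / real n \<le> real (k n) / real n"
      using eventually_gt_at_top[of 0]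
    proof eventually_elim
      case (elim n)
      have "g - 1 / real n = (g * real n - 1) / real n" using elim by (simp add: field_simps)
      also have "\<dots> \<le> real (k n) / real n" using low by (intro divide_right_mono) auto
      finally show ?case .
    qed
    show "\<forall>\<^sub>F n in sequentially. real (k n) / real n \<le> g"
      using eventually_gt_at_top[of 0]
      by eventually_elim (use g in \<open>simp add: k_def divide_le_eq\<close>)
    show "(\<lambda>n. g - 1 / real n) \<longlonglongrightarrow> g" by real_asymp
  qed simp
  have k01: "real (k n) / real n \<in> {0..1}" for n
  proof -
    have "real (k n) \<le> g * real n" using g by (simp add: k_def)
    also have "\<dots> \<le> 1 * real n" using g by (intro mult_right_mono) auto
    finally show ?thesis by (auto simp: divide_le_eq)
  qed
  \<comment> \<open>Continuity of the entropy is available only in the open interval; for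
    \<open>g = 0\<close> the sequence \<open>k n\<close> is constantly 0.\<close>
  have "(\<lambda>n. entropy (k n / n)) \<longlonglongrightarrow> entropy g"
  proof (cases "g = 0")
    case True
    then show ?thesis by (simp add: k_def)
  next
    case False
    then show ?thesis using isCont_entropy[of g] g by (intro isCont_tendsto_compose[OF _ kg]) auto
  qed
  moreover have "(\<lambda>n. gen_fun W (1 - 2 * (k n / n))) \<longlonglongrightarrow> gen_fun W (1 - 2 * g)"
  proof (rule continuous_on_tendsto_compose[OF continuous_on_gen_fun])
    show "\<forall>\<^sub>F n in sequentially. 1 - 2 * (k n / n) \<in> {-1..1}"
    proof (intro always_eventually allI)
      fix n show "1 - 2 * (k n / n) \<in> {-1..1}"
        using k01[of n] unfolding atLeastAtMost_iff by linarith
    qed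
    show "(\<lambda>n. 1 - 2 * (k n / n)) \<longlonglongrightarrow> 1 - 2 * g"
      by (intro tendsto_diff tendsto_mult tendsto_const kg)
  qed (use g in auto)
  moreover have "(\<lambda>n. ln (real n + 1) / real n) \<longlonglongrightarrow> 0" by real_asymp
  moreover have "1 + gen_fun W (1 - 2 * g) \<noteq> 0" using gen_fun_bounds[of "1 - 2 * g" W] g by auto
  ultimately have "(\<lambda>n. entropy (k n / n) - ln 2 - ln (real n + 1) / real n
      + real (m n) / real n * (ln (1 + gen_fun W (1 - 2 * (k n / n))) + c))
    \<longlonglongrightarrow> entropy g - ln 2 - 0 + \<alpha> * (ln (1 + gen_fun W (1 - 2 * g)) + c)"
    by (intro tendsto_intros m_lim)
  then show ?thesis by (simp add: Phi_def algebra_simps)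
qed

lemma growth_rate:
  "(\<lambda>n. ln (expected_null_count (Wn n) n (m n)) / real n) \<longlonglongrightarrow> F_rho (gen_fun W) \<alpha>"
proof (rule order_tendstoI)
  fix a assume a: "a < F_rho (gen_fun W) \<alpha>"
  obtain g where g: "g \<in> {0..1/2}" "a < Phi (gen_fun W) \<alpha> g"
    using F_rho_le[of "gen_fun W" \<alpha> a, OF gen_fun_bounds] alpha_pos a by (meson less_imp_le not_le)
  \<comment> \<open>Half the gap above \<open>a\<close>: \<open>\<alpha> * d\<close> equals
    \<open>(Phi - a) / 2\<close>, and \<open>e\<close> is chosen with
    \<open>ln (1 - e) = - d\<close>.\<close>
  define d where "d = (Phi (gen_fun W) \<alpha> g - a) / (2 * \<alpha>)"
  define e where "e = 1 - exp (- d)"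
  have d: "d > 0" using g alpha_pos by (simp add: d_def)
  then have e: "0 < e" "e < 1" "ln (1 - e) = - d" by (auto simp: e_def)
  have "Phi (gen_fun W) \<alpha> g + \<alpha> * ln (1 - e) > a"
    using g alpha_pos by (simp add: e(3) d_def field_simps)
  from order_tendstoD(1)[OF lower_bound_tendsto[OF g(1)] this] lower_bound[OF e(1,2) g(1)]
  show "\<forall>\<^sub>F n in sequentially. a < ln (expected_null_count (Wn n) n (m n)) / real n"
    by eventually_elim linarith
next
  fix a assume a: "a > F_rho (gen_fun W) \<alpha>"
  define d where "d = a - F_rho (gen_fun W) \<alpha>"
  \<comment> \<open>Since \<open>e <= 1\<close> and \<open>ln 2 < 1\<close>, the error terms total
    at most \<open>e * (\<alpha> + 2) <= d / 2\<close>; the other half of \<open>d\<close> absorbs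
    \<open>ln (n + 1) / n\<close>.\<close>
  define e where "e = min 1 (d / (2 * (\<alpha> + 2)))"
  have d: "d > 0" using a by (simp add: d_def)
  have e: "0 < e" "e \<le> 1" using d alpha_pos by (auto simp: e_def)
  have "e * ln 2 + (\<alpha> + e) * e = e * (ln 2 + (\<alpha> + e))" by (simp add: algebra_simps)
  also have "\<dots> \<le> e * (\<alpha> + 2)" using e ln_2_less_1 by (intro mult_left_mono) auto
  also have "\<dots> \<le> d / (2 * (\<alpha> + 2)) * (\<alpha> + 2)"
    using alpha_pos by (intro mult_right_mono) (auto simp: e_def)
  also have "\<dots> = d / 2" using alpha_pos by (simp add: field_simps)
  finally have ed: "e * ln 2 + (\<alpha> + e) * e \<le> d / 2" .
  have "(\<lambda>n. ln (real n + 1) / real n) \<longlonglongrightarrow> 0" by real_asymp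
  then have "\<forall>\<^sub>F n in sequentially. ln (real n + 1) / real n < d / 2"
    using d by (intro order_tendstoD(2)) auto
  then show "\<forall>\<^sub>F n in sequentially. ln (expected_null_count (Wn n) n (m n)) / real n < a"
    using upper_bound[OF e(1)]
  proof eventually_elim
    case (elim n)
    then show ?case using ed d_def by linarith
  qed
qed

section \<open>Error term below the threshold\<close>

lemma noncentral_term:
  assumes "\<alpha> < alpha_star (gen_fun W)" "\<delta> > 0"
  obtains c where "c > 0" "\<forall>\<^sub>F n in sequentially. \<forall>S. S \<subseteq> {..<n} \<longrightarrow> \<bar>bias n S\<bar> \<ge> \<delta> \<longrightarrow>
    exp (real n * (entropy (card S / n) - ln 2)) * (1 + mean_char (Wn n) n S) ^ m n \<le> exp (- c * real n)"
proof -
  \<comment> \<open>The smaller value \<open>\<beta>\<close> absorbs the fluctuations of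
    \<open>m n / n\<close>; the distance to \<open>\<beta>'\<close> leaves the fraction
    \<open>\<kappa>\<close> of the entropy deficit unspent.\<close>
  obtain \<beta>' where b': "\<alpha> < \<beta>'" "\<beta>' < alpha_star (gen_fun W)" using dense assms by blast
  obtain \<beta> where b: "\<alpha> < \<beta>" "\<beta> < \<beta>'" using dense b' by blast
  define \<kappa> where "\<kappa> = 1 - \<beta> / \<beta>'"
  have \<kappa>: "\<kappa> > 0" using b alpha_pos by (simp add: \<kappa>_def)
  \<comment> \<open>The unspent deficit is at least
    \<open>\<kappa> * \<delta>^2 / 2 = 2 * c\<close>; the approximation error uses
    \<open>\<beta> * e = c\<close> of it.\<close>
  define c where "c = \<kappa> * \<delta>\<^sup>2 / 4"
  have c: "c > 0" using \<kappa> assms by (simp add: c_def)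
  define e where "e = c / \<beta>"
  have e: "e > 0" using c b alpha_pos by (simp add: e_def)
  have F0: "F_rho (gen_fun W) \<beta>' = 0"
    using b' alpha_pos by (intro F_rho_eq_0 gen_fun_bounds gen_fun_0 W_pos) auto
  have Phi: "Phi (gen_fun W) \<beta> g \<le> - (2 * c)" if g: "g \<in> {0..1/2}" "1 - 2 * g \<ge> \<delta>" for g
  proof -
    define L where "L = ln (1 + gen_fun W (1 - 2 * g))"
    have "Phi (gen_fun W) \<beta>' g \<le> 0"
      using Phi_le_F_rho[of "gen_fun W" \<beta>' g, OF gen_fun_bounds] F0 g b' alpha_pos by auto
    then have "\<beta>' * L \<le> ln 2 - entropy g" by (simp add: Phi_def L_def)
    then have "\<beta> / \<beta>' * (\<beta>' * L) \<le> \<beta> / \<beta>' * (ln 2 - entropy g)"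
      using b alpha_pos by (intro mult_left_mono) auto
    moreover have "\<beta> / \<beta>' * (\<beta>' * L) = \<beta> * L" using b alpha_pos by simp
    ultimately have "Phi (gen_fun W) \<beta> g \<le> \<beta> / \<beta>' * (ln 2 - entropy g) + entropy g - ln 2"
      by (simp add: Phi_def L_def)
    also have "\<dots> = \<kappa> * (entropy g - ln 2)" by (simp add: \<kappa>_def algebra_simps)
    also have "\<dots> \<le> \<kappa> * (- (\<delta>\<^sup>2 / 2))"
    proof (rule mult_left_mono)
      have "\<delta>\<^sup>2 \<le> (1 - 2 * g)\<^sup>2" using g assms by (intro power_mono) auto
      then show "entropy g - ln 2 \<le> - (\<delta>\<^sup>2 / 2)" using entropy_le[of g] g by auto
    qed (use \<kappa> in auto)
    finally show ?thesis by (simp add: c_def)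
  qed
  have "\<forall>\<^sub>F n in sequentially. \<forall>S. S \<subseteq> {..<n} \<longrightarrow> \<bar>bias n S\<bar> \<ge> \<delta> \<longrightarrow>
    exp (real n * (entropy (card S / n) - ln 2)) * (1 + mean_char (Wn n) n S) ^ m n \<le> exp (- c * real n)"
    using mean_char_uniform[OF Wn_conv e] eventually_m_le[OF b(1)] eventually_gt_at_top[of 0]
  proof eventually_elim
    case (elim n)
    have n: "n \<ge> 1" using elim by simp
    show ?case
    proof (intro allI impI)
      fix S assume S: "S \<subseteq> {..<n}" "\<delta> \<le> \<bar>bias n S\<bar>"
      have "\<bar>mean_char (Wn n) n S - gen_fun W (bias n S)\<bar> < e" using elim(1) S by blast
      then have le: "mean_char (Wn n) n S \<le> gen_fun W (bias n S) + e" by linarith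
      have ge: "0 \<le> 1 + mean_char (Wn n) n S" using abs_mean_char_le_1[of "Wn n" n S] by linarith
      have "exp (real n * (entropy (card S / n) - ln 2)) * (1 + mean_char (Wn n) n S) ^ m n
        \<le> exp (real n * (Phi (gen_fun W) \<beta> ((1 - \<bar>bias n S\<bar>) / 2) + \<beta> * e))"
        using entropy_term_bound[OF n S(1) ge le less_imp_le[OF e] elim(2)] .
      also have "\<dots> \<le> exp (real n * (- (2 * c) + c))"
      proof -
        have "Phi (gen_fun W) \<beta> ((1 - \<bar>bias n S\<bar>) / 2) \<le> - (2 * c)"
          using abs_bias_le_1[OF S(1)] S(2) by (intro Phi) (auto simp: diff_divide_distrib)
        moreover have "\<beta> * e = c" using b alpha_pos by (simp add: e_def)
        ultimately show ?thesis unfolding exp_le_cancel_iff by (intro mult_left_mono) auto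
      qed
      finally show "exp (real n * (entropy (card S / n) - ln 2)) * (1 + mean_char (Wn n) n S) ^ m n
          \<le> exp (- c * real n)" by (simp add: mult.commute)
    qed
  qed
  then show ?thesis using that c by blast
qed

lemma expected_null_count_bigo:
  assumes r: "r0 \<ge> 3" and range: "\<forall>\<^sub>F n in sequentially. measure_pmf.prob (Wn n) {r0..r1} = 1"
    and star: "\<alpha> < alpha_star (gen_fun W)"
  shows "(\<lambda>n. expected_null_count (Wn n) n (m n) - 1) \<in> O(\<lambda>n. real n powr (2 - real r0))"
proof -
  define C0 where "C0 = (2 * real r1) ^ r1"
  define C1 where "C1 = \<alpha> + 1"
  \<comment> \<open>For \<open>\<bar>bias n S\<bar> < \<delta>\<close> and
    \<open>1 / sqrt n < \<delta>\<close> their sum is below \<open>2 * \<delta>\<close>; this value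
    of \<open>\<delta>\<close> then meets both smallness conditions of
    \<open>central_term\<close>.\<close>
  define \<delta> where "\<delta> = 1 / (32 * (C0 * C1 + 1))"
  define K where "K = C1\<^sup>2 * C0\<^sup>2 * 16 ^ r0 * fact r0 * exp (1 / 4)"
  define G where "G = 2 * exp 1 / (1 - exp (- 1 / 2 :: real))"
  have C: "C0 \<ge> 0" "C1 \<ge> 0" using alpha_pos by (auto simp: C0_def C1_def)
  then have CC: "C0 * C1 \<ge> 0" by simp
  have \<delta>: "\<delta> > 0" "2 * \<delta> \<le> 1" "16 * (C0 * C1) * (2 * \<delta>) \<le> 1"
    using CC by (auto simp: \<delta>_def divide_le_eq add_nonneg_pos)
  have K: "K \<ge> 0" by (simp add: K_def)
  have G: "G \<ge> 0" by (simp add: G_def)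
  obtain c where c: "c > 0" "\<forall>\<^sub>F n in sequentially. \<forall>S. S \<subseteq> {..<n} \<longrightarrow> \<bar>bias n S\<bar> \<ge> \<delta> \<longrightarrow>
    exp (real n * (entropy (card S / n) - ln 2)) * (1 + mean_char (Wn n) n S) ^ m n \<le> exp (- c * real n)"
    using noncentral_term[OF star \<delta>(1)] by blast
  define d where "d = \<delta>\<^sup>2 / 4"
  have d: "d > 0" using \<delta> by (simp add: d_def)
  define B where "B n = (K * (real n ^ 2 / real n ^ r0) + C1 * real n * exp (- d * real n)) * G
    + (real n + 1) * exp (- c * real n)" for n :: nat
  have sq: "\<forall>\<^sub>F n in sequentially. 1 / sqrt (real n) < \<delta>"
  proof -
    have "(\<lambda>n. 1 / sqrt (real n)) \<longlonglongrightarrow> 0" by real_asymp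
    then show ?thesis using \<delta>(1) by (rule order_tendstoD(2))
  qed
  have m_le: "\<forall>\<^sub>F n in sequentially. real (m n) \<le> C1 * real n"
    by (rule eventually_m_le) (simp add: C1_def)
  have "\<forall>\<^sub>F n in sequentially. norm (expected_null_count (Wn n) n (m n) - 1) \<le> 1 * norm (B n)"
    using c(2) range sq m_le eventually_gt_at_top[of 0]
  proof eventually_elim
    case (elim n)
    have n: "n \<ge> 1" using elim by simp
    note rng = Wn_range[OF n]
    have rng': "set_pmf (Wn n) \<subseteq> {r0..r1}"
      using elim(2) by (subst (asm) measure_pmf.prob_eq_1) (auto simp: AE_measure_pmf_iff)
    define l where "l S = mean_char (Wn n) n S" for S
    \<comment> \<open>On noncentral sets \<open>h\<close> carries the full power, which
      \<open>noncentral_term\<close> controls. The remaining \<open>- m * l <= m\<close> is charged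
      to the second summand of \<open>A\<close>: there
      \<open>exp (n * bias^2 / 4) >= exp (d * n)\<close>.\<close>
    define h where "h S = (if \<bar>bias n S\<bar> \<ge> \<delta> then (1 + l S) ^ m n else 0)" for S
    define A where "A = K * (real n ^ 2 / real n ^ r0) + C1 * real n * exp (- d * real n)"
    have l1: "- 1 \<le> l S" "l S \<le> 1" for S
      using abs_mean_char_le_1[of "Wn n" n S] by (auto simp: l_def abs_le_iff)
    have pos: "0 \<le> (1 + l S) ^ m n" for S using l1[of S] by simp
    have tm: "(1 + l S) ^ m n - 1 - real (m n) * l S \<le> A * exp (real n * (bias n S)\<^sup>2 / 4) + h S"
      if S: "S \<in> Pow {..<n}" for S
    proof (cases "\<bar>bias n S\<bar> \<ge> \<delta>")
      case False
      then have u: "\<bar>bias n S\<bar> + 1 / sqrt n \<le> 2 * \<delta>" using elim(3) by linarith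
      have "(1 + l S) ^ m n - 1 - real (m n) * l S
        \<le> K * (real n ^ 2 / real n ^ r0) * exp (real n * (bias n S)\<^sup>2 / 4)"
        unfolding K_def
      proof (rule central_term[OF n r l1(1) _ C elim(4)])
        show "\<bar>l S\<bar> \<le> C0 * (\<bar>bias n S\<bar> + 1 / sqrt n) ^ r0"
          unfolding l_def C0_def using S by (intro abs_mean_char_le[OF _ n rng rng']) auto
        show "\<bar>bias n S\<bar> + 1 / sqrt n \<le> 1" using u \<delta>(2) by linarith
        have "16 * (C0 * C1) * (\<bar>bias n S\<bar> + 1 / sqrt n) \<le> 16 * (C0 * C1) * (2 * \<delta>)"
          using u CC by (intro mult_left_mono) auto
        then show "16 * (C0 * C1) * (\<bar>bias n S\<bar> + 1 / sqrt n) \<le> 1" using \<delta>(3) by linarith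
      qed
      also have "\<dots> \<le> A * exp (real n * (bias n S)\<^sup>2 / 4)"
        unfolding A_def using C by (intro mult_right_mono) auto
      finally show ?thesis using False by (simp add: h_def)
    next
      case True
      have "\<delta>\<^sup>2 \<le> \<bar>bias n S\<bar>\<^sup>2" using True \<delta> by (intro power_mono) auto
      then have "real n * \<delta>\<^sup>2 \<le> real n * (bias n S)\<^sup>2" by (intro mult_left_mono) auto
      then have "1 \<le> exp (- d * real n + real n * (bias n S)\<^sup>2 / 4)"
        by (simp add: d_def mult.commute)
      then have "real (m n) * 1 \<le> C1 * real n * (exp (- d * real n) * exp (real n * (bias n S)\<^sup>2 / 4))"
        using elim(4) C unfolding exp_add[symmetric] by (intro mult_mono) auto
      also have "\<dots> = C1 * real n * exp (- d * real n) * exp (real n * (bias n S)\<^sup>2 / 4)"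
        by (simp only: mult.assoc)
      also have "\<dots> \<le> A * exp (real n * (bias n S)\<^sup>2 / 4)"
        unfolding A_def using K by (intro mult_right_mono) auto
      finally have "real (m n) \<le> A * exp (real n * (bias n S)\<^sup>2 / 4)" by simp
      moreover have "real (m n) * (- l S) \<le> real (m n) * 1" using l1[of S] by (intro mult_left_mono) auto
      ultimately show ?thesis using True by (simp add: h_def)
    qed
    have "0 \<le> A" unfolding A_def using K C by (intro add_nonneg_nonneg mult_nonneg_nonneg) auto
    have "expected_null_count (Wn n) n (m n) - 1
        = (\<Sum>S\<in>Pow {..<n}. (1 + l S) ^ m n - 1 - real (m n) * l S) / 2 ^ n"
      unfolding l_def by (rule expected_null_count_minus_1[OF rng])
    also have "\<dots> \<le> (\<Sum>S\<in>Pow {..<n}. A * exp (real n * (bias n S)\<^sup>2 / 4) + h S) / 2 ^ n"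
      by (intro divide_right_mono sum_mono tm) auto
    also have "\<dots> = A * ((\<Sum>S\<in>Pow {..<n}. exp (real n * (bias n S)\<^sup>2 / 4)) / 2 ^ n)
        + (\<Sum>S\<in>Pow {..<n}. h S) / 2 ^ n"
      by (simp add: sum.distrib sum_distrib_left add_divide_distrib)
    also have "\<dots> \<le> A * G + (real n + 1) * exp (- c * real n)"
    proof (intro add_mono mult_left_mono)
      show "(\<Sum>S\<in>Pow {..<n}. exp (real n * (bias n S)\<^sup>2 / 4)) / 2 ^ n \<le> G"
        unfolding G_def by (rule gaussian_moment_bias[OF n])
      show "(\<Sum>S\<in>Pow {..<n}. h S) / 2 ^ n \<le> (real n + 1) * exp (- c * real n)"
      proof (rule sum_Pow_le_entropy[OF n])
        fix S assume "S \<subseteq> {..<n}"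
        then show "exp (real n * (entropy (card S / n) - ln 2)) * h S \<le> exp (- c * real n)"
          using elim(1) by (cases "\<bar>bias n S\<bar> \<ge> \<delta>") (simp_all add: h_def l_def)
      qed simp
    qed fact
    finally have "expected_null_count (Wn n) n (m n) - 1 \<le> B n" by (simp add: B_def A_def)
    \<comment> \<open>The one-sided bound suffices, since the expectation is at least 1.\<close>
    then show ?case using expected_null_count_ge_1[OF rng, of "m n"] by simp
  qed
  then have "(\<lambda>n. expected_null_count (Wn n) n (m n) - 1) \<in> O(B)" by (rule bigoI)
  also have "B \<in> O(\<lambda>n. real n powr (2 - real r0))"
  proof -
    have "(\<lambda>n. real n ^ 2 / real n ^ r0) \<in> O(\<lambda>n. real n powr (2 - real r0))"
    proof (rule bigoI[where c = 1], use eventually_gt_at_top[of 0] in eventually_elim)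
      case (elim n)
      then show ?case by (simp add: powr_diff powr_realpow)
    qed
    moreover have "(\<lambda>n. real n * exp (- d * real n)) \<in> O(\<lambda>n. real n powr (2 - real r0))"
      using d by real_asymp
    moreover have "(\<lambda>n. (real n + 1) * exp (- c * real n)) \<in> O(\<lambda>n. real n powr (2 - real r0))"
      using c(1) by real_asymp
    ultimately have "(\<lambda>n. (K * G) * (real n ^ 2 / real n ^ r0) + (C1 * G) * (real n * exp (- d * real n))
        + (real n + 1) * exp (- c * real n)) \<in> O(\<lambda>n. real n powr (2 - real r0))"
      by (intro sum_in_bigo cmult_in_bigo_iff[THEN iffD2] disjI2)
    moreover have "B = (\<lambda>n. (K * G) * (real n ^ 2 / real n ^ r0) + (C1 * G) * (real n * exp (- d * real n))
        + (real n + 1) * exp (- c * real n))"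
      by (simp add: B_def fun_eq_iff algebra_simps)
    ultimately show ?thesis by simp
  qed
  finally show ?thesis .
qed

end

theorem theorem2p2:
  fixes W :: "nat pmf" and Wn :: "nat \<Rightarrow> nat pmf"
    and m :: "nat \<Rightarrow> nat" and \<alpha> :: real
  assumes W_pos: "set_pmf W \<subseteq> {1..}"
    and Wn_range: "\<And>n. n \<ge> 1 \<Longrightarrow> set_pmf (Wn n) \<subseteq> {1..n}"
    and Wn_conv: "converges_in_distribution Wn W"
    and m_pos: "\<And>n. n \<ge> 1 \<Longrightarrow> m n \<ge> 1"
    and alpha_pos: "\<alpha> > 0"
    and m_lim: "(\<lambda>n. real (m n) / real n) \<longlonglongrightarrow> \<alpha>"
  shows "((\<lambda>n. ln (expected_null_count (Wn n) n (m n)) / real n)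
            \<longlonglongrightarrow> F_rho (gen_fun W) \<alpha>)
    \<and> (\<alpha> > alpha_star (gen_fun W) \<longrightarrow> F_rho (gen_fun W) \<alpha> > 0)
    \<and> (\<alpha> \<le> alpha_star (gen_fun W) \<longrightarrow> F_rho (gen_fun W) \<alpha> = 0)
    \<and> (\<forall>r0 r1 :: nat. r0 \<ge> 3
          \<longrightarrow> (\<forall>\<^sub>F n in sequentially. measure_pmf.prob (Wn n) {r0..r1} = 1)
          \<longrightarrow> \<alpha> < alpha_star (gen_fun W)
          \<longrightarrow> (\<lambda>n. expected_null_count (Wn n) n (m n) - 1) \<in> O(\<lambda>n. real n powr (2 - real r0)))"
proof -
  note growth = growth_rate[OF W_pos Wn_range Wn_conv alpha_pos m_lim]
  have one: "gen_fun W 1 = 1" by (simp add: gen_fun_def)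
  have pos: "F_rho (gen_fun W) \<alpha> > 0" if "\<alpha> > alpha_star (gen_fun W)"
    using one that by (intro F_rho_pos gen_fun_bounds)
  have zero: "F_rho (gen_fun W) \<alpha> = 0" if "\<alpha> \<le> alpha_star (gen_fun W)"
    using that by (intro F_rho_eq_0 gen_fun_bounds gen_fun_0 W_pos alpha_pos)
  note error = expected_null_count_bigo[OF W_pos Wn_range Wn_conv alpha_pos m_lim]
  show ?thesis using growth pos zero error by blast
qed

end
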